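(* Let $\mathcal{G}$ be a non-degenerate Hessenberg matrix. Then there exist $d\in\mathbb{Z}_+$ and $\vec{\mu}_d=(\mu_0,\dots,\mu_d)\in\mathfrak{M}_d(\mathbb{R})$, with $\mu_0$ having infinite support and $\mu_1,\dots,\mu_d$ supported on finite subsets, such that $\langle p,q\rangle_{\vec{\mu}_d}=\langle p,q\rangle_{\mathcal{G}}$ for all $p,q\in\mathbb{P}$, if and only if there exists $d\in\mathbb{Z}_+$ such that 1. $\mathcal{G}$ is a Hessenberg-Sobolev matrix of index $d$; and 2. with the Hankel matrices defined, for $k=0,1,\dots,d$, by $$\mathcal{H}_{d-k}=\frac{(-1)^{d-k}}{(2d-2k)!}\,\Phi(\mathcal{M}_{d-k},2d-2k),$$ where $\mathcal{M}_d=\mathcal{M}_{\mathcal{G}}$ and $\mathcal{M}_{d-k}=\mathcal{M}_{d-k+1}-\mathcal{U}^{-d-1+k}\mathcal{D}_{d+1-k}\mathcal{H}_{d+1-k}\mathcal{D}_{d+1-k}\mathcal{U}^{d+1-k}$ for $k=1,\dots,d$, the matrix $\mathcal{H}_0$ is positive definite of infinite order and, for each $k=0,1,\dots,d-1$, the matrix $\mathcal{H}_{d-k}$ is positive definite of order $m_k$ for some $m_k\in\mathbb{Z}_+$.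
   Context: $\mathbb{Z}_+=\{0,1,2,\dots\}$; $\mathbb{P}$ is the space of real polynomials. Infinite matrices have real entries indexed by $(i,j)\in\mathbb{Z}_+\times\mathbb{Z}_+$; $\mathcal{O}$ is the infinite null matrix, $\mathcal{I}$ the infinite unit matrix. All products of infinite matrices considered are such that each entry is a sum with finitely many nonzero terms. $\mathcal{U}$ is the infinite matrix with $(i,j)$ entry $\delta_{i+1,j}$; $\mathcal{U}^{-1}:=\mathcal{U}^{\mathsf T}$ and $\mathcal{U}^{-m}:=(\mathcal{U}^{-1})^m$. $[\mathcal{A}]_n$ is the matrix of the first $n$ rows and columns of $\mathcal{A}$; $\mathcal{A}$ is positive definite of infinite order if $\det([\mathcal{A}]_n)>0$ for all $n\ge 1$, and positive definite of order $k$ if $\det([\mathcal{A}]_n)>0$ for $1\le n\le k$ and $\det([\mathcal{A}]_n)=0$ for all $n>k$. A non-degenerate Hessenberg matrix is an infinite real matrix $\mathcal{G}=(g_{i,j})_{i,j\ge0}$ with $g_{i,j}=0$ whenever $j-i>1$ and $g_{i,i+1}\neq 0$ for all $i\ge 0$. The polynomials $\{Q_n\}$ generated by $\mathcal{G}$ are defined by $Q_0=t_{0,0}$ (a fixed constant $t_{0,0}>0$) and $g_{n,n+1}Q_{n+1}(x)=xQ_n(x)-\sum_{k=0}^n g_{n,k}Q_k(x)$, $n\ge 0$. Write $Q_n(x)=\sum_{i=0}^n t_{n,i}x^i$ and let $\mathcal{T}=(t_{n,i})$ be the corresponding lower triangular infinite matrix; it has a unique two-sided lower triangular inverse $\mathcal{T}^{-1}$.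 With $\mathcal{T}^{-\mathsf T}=(\mathcal{T}^{-1})^{\mathsf T}$, the matrix of formal moments of $\mathcal{G}$ is $\mathcal{M}_{\mathcal{G}}=(m_{i,j}):=\mathcal{T}^{-1}\mathcal{T}^{-\mathsf T}$. For $p=\sum_{i=0}^{n_1} a_ix^i$, $q=\sum_{j=0}^{n_2} b_jx^j$, $\langle p,q\rangle_{\mathcal{G}}:=\sum_{i=0}^{n_1}\sum_{j=0}^{n_2}a_i\,m_{i,j}\,b_j$. A matrix $\mathcal{H}=(h_{i,j})$ is Hankel if $h_{i,j+1}=h_{i+1,j}$ for all $i,j\ge 0$. $\mathcal{D}_0=\mathcal{I}$ and, for $k>0$, $\mathcal{D}_k$ is the infinite diagonal matrix with $i$th diagonal entry $\frac{(k+i)!}{i!}$, $i\ge0$. $\mathcal{M}$ is a Hankel-Sobolev matrix if there are Hankel matrices $\{\mathcal{H}_k\}_{k=0}^\infty$ with $\mathcal{M}=\sum_{k=0}^{\infty}\mathcal{U}^{-k}\mathcal{D}_k\mathcal{H}_k\mathcal{D}_k\mathcal{U}^{k}$; it is of index $d\in\mathbb{Z}_+$ if $\mathcal{H}_d\neq\mathcal{O}$ and $\mathcal{H}_k=\mathcal{O}$ for all $k>d$. $\mathcal{G}$ is a Hessenberg-Sobolev matrix of index $d$ if $\mathcal{M}_{\mathcal{G}}$ is a Hankel-Sobolev matrix of index $d$. For $\eta\in\mathbb{Z}_+$, $\Phi(\mathcal{A},\eta):=\sum_{\ell=0}^{\eta}(-1)^\ell\binom{\eta}{\ell}\,\mathcal{U}^{\eta-\ell}\mathcal{A}\,\mathcal{U}^{-\ell}$.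 For $d\in\mathbb{Z}_+$, $\vec{\mu}_d=(\mu_0,\dots,\mu_d)\in\mathfrak{M}_d(\mathbb{R})$ means that each $\mu_k$ is a non-negative finite Borel measure (possibly zero for $k\geq 1$) with support $\Delta_k\subset\mathbb{R}$, $\mathbb{P}\subset \mathbf{L}_1(\mu_k)$, $\mu_0$ is positive and $\Delta_0$ contains infinitely many points. For such $\vec{\mu}_d$, $\langle f,g\rangle_{\vec{\mu}_d}:=\sum_{k=0}^d\int f^{(k)}(x)g^{(k)}(x)\,d\mu_k(x)$ for $f,g\in\mathbb{P}$, where $f^{(k)}$ is the $k$th derivative. *)

theory Defs
  imports
    "HOL-Analysis.Analysis"
    "HOL-Library.Groups_Big_Fun"
    "HOL-Computational_Algebra.Polynomial"
    "Jordan_Normal_Form.Determinant"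
begin

section \<open>Infinite matrices\<close>

type_synonym infmat = "nat \<Rightarrow> nat \<Rightarrow> real"

definition inf_zero :: infmat where
  "inf_zero = (\<lambda>i j. 0)"

definition inf_one :: infmat where
  "inf_one = (\<lambda>i j. if i = j then 1 else 0)"

text \<open>Each entry is the sum of the nonzero terms; \<^const>\<open>Sum_any\<close> returns 0 when there are
  infinitely many of them, which does not happen for any product formed below.\<close>

definition inf_mult :: "infmat \<Rightarrow> infmat \<Rightarrow> infmat"  (infixl \<open>*\<^sub>\<infinity>\<close> 70) where
  "A *\<^sub>\<infinity> B = (\<lambda>i j. Sum_any (\<lambda>k. A i k * B k j))"

definition inf_transpose :: "infmat \<Rightarrow> infmat" where
  "inf_transpose A = (\<lambda>i j. A j i)"

primrec inf_power :: "infmat \<Rightarrow> nat \<Rightarrow> infmat" where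
  "inf_power A 0 = inf_one"
| "inf_power A (Suc m) = inf_power A m *\<^sub>\<infinity> A"

definition shift :: infmat where
  "shift = (\<lambda>i j. if i + 1 = j then 1 else 0)"

text \<open>\<open>shift_pos m\<close> is $U^m$ and \<open>shift_neg m\<close> is $U^{-m} = (U^T)^m$. Here $U^T$ is only a right
  inverse of $U$.\<close>

definition shift_pos :: "nat \<Rightarrow> infmat" where
  "shift_pos m = inf_power shift m"

definition shift_neg :: "nat \<Rightarrow> infmat" where
  "shift_neg m = inf_power (inf_transpose shift) m"

definition lower_triangular_inf :: "infmat \<Rightarrow> bool" where
  "lower_triangular_inf A \<longleftrightarrow> (\<forall>i j. i < j \<longrightarrow> A i j = 0)"

text \<open>Meant for lower triangular matrices with nonzero diagonal, where such an inverse exists and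
  is unique.\<close>

definition lower_inverse :: "infmat \<Rightarrow> infmat" where
  "lower_inverse A =
     (THE B. lower_triangular_inf B \<and> A *\<^sub>\<infinity> B = inf_one \<and> B *\<^sub>\<infinity> A = inf_one)"

definition leading_section :: "infmat \<Rightarrow> nat \<Rightarrow> real mat" where
  "leading_section A n = Matrix.mat n n (\<lambda>(i, j). A i j)"

definition pos_def_inf :: "infmat \<Rightarrow> bool" where
  "pos_def_inf A \<longleftrightarrow> (\<forall>n\<ge>1. Determinant.det (leading_section A n) > 0)"

definition pos_def_order :: "nat \<Rightarrow> infmat \<Rightarrow> bool" where
  "pos_def_order k A \<longleftrightarrow>
     (\<forall>n. 1 \<le> n \<and> n \<le> k \<longrightarrow> Determinant.det (leading_section A n) > 0) \<and>
     (\<forall>n>k. Determinant.det (leading_section A n) = 0)"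


section \<open>Hessenberg matrices and formal moments\<close>

definition nondegenerate_hessenberg :: "infmat \<Rightarrow> bool" where
  "nondegenerate_hessenberg G \<longleftrightarrow>
     (\<forall>i j. i + 1 < j \<longrightarrow> G i j = 0) \<and> (\<forall>i. G i (i + 1) \<noteq> 0)"

text \<open>The argument \<open>t00\<close> is the constant value of $Q_0$.\<close>

fun gen_poly :: "infmat \<Rightarrow> real \<Rightarrow> nat \<Rightarrow> real poly" where
  "gen_poly G t00 0 = [:t00:]"
| "gen_poly G t00 (Suc n) =
     Polynomial.smult (1 / G n (Suc n))
       ([:0, 1:] * gen_poly G t00 n - (\<Sum>k\<le>n. Polynomial.smult (G n k) (gen_poly G t00 k)))"

definition coeff_matrix :: "infmat \<Rightarrow> real \<Rightarrow> infmat" where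
  "coeff_matrix G t00 = (\<lambda>n i. Polynomial.coeff (gen_poly G t00 n) i)"

definition formal_moments :: "infmat \<Rightarrow> real \<Rightarrow> infmat" where
  "formal_moments G t00 =
     lower_inverse (coeff_matrix G t00) *\<^sub>\<infinity> inf_transpose (lower_inverse (coeff_matrix G t00))"

definition hessenberg_form :: "infmat \<Rightarrow> real \<Rightarrow> real poly \<Rightarrow> real poly \<Rightarrow> real" where
  "hessenberg_form G t00 p q =
     (\<Sum>i\<le>Polynomial.degree p. \<Sum>j\<le>Polynomial.degree q.
        Polynomial.coeff p i * formal_moments G t00 i j * Polynomial.coeff q j)"


section \<open>Hankel-Sobolev and Hessenberg-Sobolev matrices\<close>

definition hankel :: "infmat \<Rightarrow> bool" where
  "hankel H \<longleftrightarrow> (\<forall>i j. H i (j + 1) = H (i + 1) j)"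

definition diag_mat_inf :: "nat \<Rightarrow> infmat" where
  "diag_mat_inf k = (\<lambda>i j. if i = j then fact (k + i) / fact i else 0)"

definition sobolev_term :: "nat \<Rightarrow> infmat \<Rightarrow> infmat" where
  "sobolev_term k H =
     shift_neg k *\<^sub>\<infinity> diag_mat_inf k *\<^sub>\<infinity> H *\<^sub>\<infinity> diag_mat_inf k *\<^sub>\<infinity> shift_pos k"

text \<open>The \<open>(i, j)\<close> entry of \<open>sobolev_term k H\<close> vanishes unless \<open>k \<le> i\<close> and \<open>k \<le> j\<close>, so the
  infinite sum of matrices is a finite sum in each entry.\<close>

definition hankel_sobolev_decomp :: "infmat \<Rightarrow> (nat \<Rightarrow> infmat) \<Rightarrow> bool" where
  "hankel_sobolev_decomp M H \<longleftrightarrow>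
     (\<forall>k. hankel (H k)) \<and> M = (\<lambda>i j. Sum_any (\<lambda>k. sobolev_term k (H k) i j))"

definition hankel_sobolev :: "infmat \<Rightarrow> nat \<Rightarrow> bool" where
  "hankel_sobolev M d \<longleftrightarrow>
     (\<exists>H. hankel_sobolev_decomp M H \<and> H d \<noteq> inf_zero \<and> (\<forall>k>d. H k = inf_zero))"

definition hessenberg_sobolev :: "infmat \<Rightarrow> real \<Rightarrow> nat \<Rightarrow> bool" where
  "hessenberg_sobolev G t00 d \<longleftrightarrow> hankel_sobolev (formal_moments G t00) d"

definition Phi :: "infmat \<Rightarrow> nat \<Rightarrow> infmat" where
  "Phi A \<eta> = (\<lambda>i j. \<Sum>l\<le>\<eta>. (-1) ^ l * real (\<eta> choose l) *
                (shift_pos (\<eta> - l) *\<^sub>\<infinity> A *\<^sub>\<infinity> shift_neg l) i j)"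

definition top_hankel :: "infmat \<Rightarrow> nat \<Rightarrow> infmat" where
  "top_hankel A e = (\<lambda>i j. (-1) ^ e / fact (2 * e) * Phi A (2 * e) i j)"

text \<open>\<open>residual M d k\<close> and \<open>extracted M d k\<close> are the matrices usually written $M_{d-k}$ and
  $H_{d-k}$, for \<open>k \<le> d\<close>. In particular \<open>extracted M d d\<close> is $H_0$.\<close>

primrec residual :: "infmat \<Rightarrow> nat \<Rightarrow> nat \<Rightarrow> infmat" where
  "residual M d 0 = M"
| "residual M d (Suc k) = (\<lambda>i j. residual M d k i j
     - sobolev_term (d - k) (top_hankel (residual M d k) (d - k)) i j)"

definition extracted :: "infmat \<Rightarrow> nat \<Rightarrow> nat \<Rightarrow> infmat" where
  "extracted M d k = top_hankel (residual M d k) (d - k)"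


section \<open>Sobolev inner products\<close>

definition measure_support :: "real measure \<Rightarrow> real set" where
  "measure_support \<mu> = {x. \<forall>U. open U \<and> x \<in> U \<longrightarrow> emeasure \<mu> U > 0}"

text \<open>Only \<open>\<mu> 0, \<dots>, \<mu> d\<close> are relevant. Requiring \<open>\<mu> 0\<close> to be nonzero is implied by the infinite
  support.\<close>

definition sobolev_measures :: "nat \<Rightarrow> (nat \<Rightarrow> real measure) \<Rightarrow> bool" where
  "sobolev_measures d \<mu> \<longleftrightarrow>
     (\<forall>k\<le>d. sets (\<mu> k) = sets borel \<and> finite_measure (\<mu> k) \<and>
            (\<forall>p::real poly. integrable (\<mu> k) (poly p))) \<and>
     emeasure (\<mu> 0) UNIV > 0 \<and> infinite (measure_support (\<mu> 0))"

definition sobolev_form :: "nat \<Rightarrow> (nat \<Rightarrow> real measure) \<Rightarrow> real poly \<Rightarrow> real poly \<Rightarrow> real" where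
  "sobolev_form d \<mu> f g =
     (\<Sum>k\<le>d. \<integral>x. poly ((pderiv ^^ k) f) x * poly ((pderiv ^^ k) g) x \<partial>(\<mu> k))"

end

theory Submission
  imports Defs "HOL-Probability.Helly_Selection"
    "HOL-Computational_Algebra.Fundamental_Theorem_Algebra"
begin

text \<open>The Sobolev form is the bilinear form whose matrix is
  \<open>\<Sum>\<^sub>k U\<^sup>-\<^sup>k D\<^sub>k H\<^sub>k D\<^sub>k U\<^sup>k\<close>, where \<open>H\<^sub>k\<close> is the Hankel matrix of moments of \<open>\<mu>\<^sub>k\<close>. The
  \<open>(i, j)\<close> entry of the \<open>k\<close>-th term is a product of two falling factorials of length \<open>k\<close> times a
  function of \<open>i + j\<close>. Along an antidiagonal this is a polynomial of degree \<open>2k\<close>, so \<open>\<Phi>(\<cdot>, 2e)\<close>, a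
  difference operator of order \<open>2e\<close>, kills all terms with \<open>k < e\<close> and returns a multiple of
  \<open>H\<^sub>e\<close> for \<open>k = e\<close>. Hence the \<open>H\<^sub>k\<close> are recovered one after the other, and the claim reduces to two moment
  problems. If all Hankel determinants are positive, Gauss quadrature at the zeros of the orthogonal
  polynomials gives finitely supported solutions of the truncated problems, and by Helly's theorem
  a subsequence of them converges to a solution. If the determinants vanish beyond order \<open>m\<close>, the orthogonal
  polynomial of degree \<open>m\<close> annihilates the moment functional, and its quadrature formula is exact.\<close>

section \<open>Extraction of the Hankel matrices\<close>

text \<open>The falling factorial n(n-1)...(n-k+1). Real factors make it visibly a polynomial of
  degree k in n, while it still vanishes for n < k.\<close>

definition falling :: "nat \<Rightarrow> nat \<Rightarrow> real" where
  "falling n k = (\<Prod>t<k. real n - real t)"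

lemma falling_eq_0: "n < k \<Longrightarrow> falling n k = 0"
  unfolding falling_def by (rule prod_zero) auto

lemma falling_Suc: "falling n (Suc k) = falling n k * (real n - real k)"
  by (simp add: falling_def)

lemma falling_add: "falling (k + n) k = fact (k + n) / fact n"
proof (induction k arbitrary: n)
  case (Suc k)
  have "falling (Suc k + n) (Suc k) = falling (k + Suc n) k * real (Suc n)"
    by (simp add: falling_Suc)
  also have "\<dots> = fact (k + Suc n) / fact (Suc n) * real (Suc n)"
    by (simp only: Suc.IH)
  also have "\<dots> = fact (Suc k + n) / fact n"
    by (simp add: field_simps del: of_nat_Suc)
  finally show ?case .
qed (simp add: falling_def)

text \<open>Shift and diagonal matrices have at most one nonzero entry in each row and column, so
  products with them collapse to a single term and the default value of \<open>Sum_any\<close> does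
  not interfere.\<close>

lemma inf_mult_row:
  assumes "\<And>k. k \<noteq> r \<Longrightarrow> A i k = 0"
  shows "(A *\<^sub>\<infinity> B) i j = A i r * B r j"
proof -
  have "{k. A i k * B k j \<noteq> 0} \<subseteq> {r}" using assms by auto
  then show ?thesis
    unfolding inf_mult_def by (subst Sum_any.expand_superset[of "{r}"]) auto
qed

lemma inf_mult_col:
  assumes "\<And>k. k \<noteq> c \<Longrightarrow> B k j = 0"
  shows "(A *\<^sub>\<infinity> B) i j = A i c * B c j"
proof -
  have "{k. A i k * B k j \<noteq> 0} \<subseteq> {c}" using assms by auto
  then show ?thesis
    unfolding inf_mult_def by (subst Sum_any.expand_superset[of "{c}"]) auto
qed

lemma shift_pos_entry: "shift_pos m i j = (if i + m = j then 1 else 0)"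
proof (induction m arbitrary: j)
  case (Suc m)
  have "shift_pos (Suc m) i j = (shift_pos m *\<^sub>\<infinity> shift) i j"
    by (simp add: shift_pos_def)
  also have "\<dots> = shift_pos m i (i + m) * shift (i + m) j"
    by (rule inf_mult_row) (simp add: Suc.IH)
  finally show ?case by (simp add: Suc.IH shift_def)
qed (simp add: shift_pos_def inf_one_def)

lemma shift_neg_entry: "shift_neg m i j = (if i = j + m then 1 else 0)"
proof (induction m arbitrary: j)
  case (Suc m)
  have "shift_neg (Suc m) i j = (shift_neg m *\<^sub>\<infinity> inf_transpose shift) i j"
    by (simp add: shift_neg_def)
  also have "\<dots> = shift_neg m i (j + 1) * inf_transpose shift (j + 1) j"
    by (rule inf_mult_col) (simp add: shift_def inf_transpose_def)
  finally show ?case by (simp add: Suc.IH shift_def inf_transpose_def)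
qed (simp add: shift_neg_def inf_one_def)

lemma shift_pos_mult: "(shift_pos m *\<^sub>\<infinity> A) i j = A (i + m) j"
  using inf_mult_row[of "i + m" "shift_pos m" i A j] by (simp add: shift_pos_entry)

lemma mult_shift_neg: "(A *\<^sub>\<infinity> shift_neg m) i j = A i (j + m)"
  using inf_mult_col[of "j + m" "shift_neg m" j A i] by (simp add: shift_neg_entry)

lemma mult_shift_pos: "(A *\<^sub>\<infinity> shift_pos m) i j = (if m \<le> j then A i (j - m) else 0)"
  using inf_mult_col[of "j - m" "shift_pos m" j A i] by (auto simp add: shift_pos_entry)

lemma mult_diag_mat_inf: "(A *\<^sub>\<infinity> diag_mat_inf k) i j = A i j * falling (k + j) k"
  using inf_mult_col[of j "diag_mat_inf k" j A i] by (auto simp add: diag_mat_inf_def falling_add)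

lemma sobolev_term_entry:
  "sobolev_term k H i j = (if k \<le> i \<and> k \<le> j then falling i k * falling j k * H (i - k) (j - k) else 0)"
proof -
  have *: "(shift_neg k *\<^sub>\<infinity> diag_mat_inf k *\<^sub>\<infinity> H) i b = (if k \<le> i then falling i k * H (i - k) b else 0)"
    for b
    using inf_mult_row[of "i - k" "shift_neg k *\<^sub>\<infinity> diag_mat_inf k" i H b]
    by (auto simp add: mult_diag_mat_inf shift_neg_entry)
  show ?thesis
    unfolding sobolev_term_def mult_shift_pos mult_diag_mat_inf * by (auto simp: algebra_simps)
qed

lemma hankel_entry: "hankel H \<Longrightarrow> H i j = H 0 (i + j)"
proof (induction i arbitrary: j)
  case (Suc i)
  then show ?case
    using Suc.IH[of "Suc j"] by (simp add: hankel_def)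
qed simp

text \<open>Outside the range k \<le> i, j a falling factorial vanishes, so no case distinction
  remains and the truncated subtraction does no harm. Along an antidiagonal the value of
  \<open>H\<close> is constant.\<close>

lemma sobolev_term_hankel:
  assumes "hankel H"
  shows "sobolev_term k H i j = falling i k * falling j k * H 0 (i + j - 2 * k)"
proof (cases "k \<le> i \<and> k \<le> j")
  case True
  then have "i - k + (j - k) = i + j - 2 * k" by auto
  then show ?thesis
    using True hankel_entry[OF assms, of "i - k" "j - k"] by (simp add: sobolev_term_entry)
next
  case False
  then have "falling i k = 0 \<or> falling j k = 0" using falling_eq_0[of i k] falling_eq_0[of j k] by linarith
  then show ?thesis using False by (auto simp: sobolev_term_entry)
qed

lemma sobolev_term_zero [simp]: "sobolev_term k inf_zero i j = 0"
  by (simp add: sobolev_term_entry inf_zero_def)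

section \<open>Finite differences of order 2e along antidiagonals\<close>

lemma top_hankel_entry:
  "top_hankel A e i j =
     (-1) ^ e / fact (2 * e) *
       (\<Sum>l\<le>2 * e. (-1) ^ l * real (2 * e choose l) * A (i + (2 * e - l)) (j + l))"
  by (simp add: top_hankel_def Phi_def mult_shift_neg shift_pos_mult)

lemma top_hankel_sum:
  "top_hankel (\<lambda>i j. \<Sum>k\<in>S. A k i j) e i j = (\<Sum>k\<in>S. top_hankel (A k) e i j)"
  unfolding top_hankel_entry sum_distrib_left by (rule sum.swap)

text \<open>The N-th finite difference kills polynomials of degree below N and turns x^N into a
  multiple of N!. The polynomial is given by a list of pairs (slope, intercept), so that the
  induction can split off one factor and the leading coefficient is the product of the slopes. A
  factor l is absorbed by (l+1) C(M+1, l+1) = (M+1) C(M, l), which lowers the order by one.\<close>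

lemma alternating_sum_linear_factors:
  assumes "length cs \<le> N"
  shows "(\<Sum>l\<le>N. (-1) ^ l * real (N choose l) * (\<Prod>c\<leftarrow>cs. fst c * real l + snd c)) =
    (if length cs = N then (-1) ^ N * fact N * (\<Prod>c\<leftarrow>cs. fst c) else 0)"
  using assms
proof (induction "length cs" arbitrary: cs N)
  case 0
  then show ?case
    using choose_alternating_sum[of N, where ?'a = real] by (cases "N = 0") auto
next
  case (Suc n)
  from Suc(2) obtain c ds where cs: "cs = c # ds" by (cases cs) auto
  from Suc(3) cs obtain M where N: "N = Suc M" by (cases N) auto
  define g where "g l = (\<Prod>c\<leftarrow>ds. fst c * real l + snd c)" for l
  \<comment> \<open>Replacing l by l + 1 changes only the intercepts, so the product of the slopes
    is kept.\<close>
  define ds' where "ds' = map (\<lambda>c. (fst c, fst c + snd c)) ds"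
  have g': "(\<Prod>c\<leftarrow>ds'. fst c * real l + snd c) = g (Suc l)" for l
    unfolding g_def ds'_def by (induction ds) (auto simp: algebra_simps)
  have len: "length ds' = length ds" and fst: "(\<Prod>c\<leftarrow>ds'. fst c) = (\<Prod>c\<leftarrow>ds. fst c)"
    unfolding ds'_def by (auto simp: comp_def)
  have "(\<Sum>l\<le>N. (-1) ^ l * real (N choose l) * (real l * g l)) =
      (\<Sum>l\<le>M. (-1) ^ Suc l * (real (Suc M choose Suc l) * real (Suc l)) * g (Suc l))"
    unfolding N sum.atMost_Suc_shift by (simp add: mult.assoc del: binomial_Suc_Suc)
  also have "\<dots> = (\<Sum>l\<le>M. - real N * ((-1) ^ l * real (M choose l) * g (Suc l)))"
  proof (rule sum.cong)
    fix l
    have "real (Suc M choose Suc l) * real (Suc l) = real N * real (M choose l)"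
      using Suc_times_binomial[of l M] N by (metis mult.commute of_nat_mult)
    then show "(-1) ^ Suc l * (real (Suc M choose Suc l) * real (Suc l)) * g (Suc l) =
        - real N * ((-1) ^ l * real (M choose l) * g (Suc l))" by simp
  qed simp
  also have "\<dots> = - real N * (\<Sum>l\<le>M. (-1) ^ l * real (M choose l) * g (Suc l))"
    by (simp only: sum_distrib_left)
  also have "(\<Sum>l\<le>M. (-1) ^ l * real (M choose l) * g (Suc l)) =
      (if length ds = M then (-1) ^ M * fact M * (\<Prod>c\<leftarrow>ds. fst c) else 0)"
    using Suc(1)[of ds' M] Suc(2,3) by (simp add: cs N g' len fst)
  finally have 1: "(\<Sum>l\<le>N. (-1) ^ l * real (N choose l) * (real l * g l)) =
      - real N * (if length ds = M then (-1) ^ M * fact M * (\<Prod>c\<leftarrow>ds. fst c) else 0)" .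
  have 2: "(\<Sum>l\<le>N. (-1) ^ l * real (N choose l) * g l) = 0"
    using Suc(1)[of ds N] Suc(2,3) by (simp add: cs N g_def)
  have "(\<Sum>l\<le>N. (-1) ^ l * real (N choose l) * (\<Prod>c\<leftarrow>cs. fst c * real l + snd c)) =
      (\<Sum>l\<le>N. fst c * ((-1) ^ l * real (N choose l) * (real l * g l)) +
        snd c * ((-1) ^ l * real (N choose l) * g l))"
    by (rule sum.cong) (simp_all add: cs g_def algebra_simps)
  also have "\<dots> = fst c * (\<Sum>l\<le>N. (-1) ^ l * real (N choose l) * (real l * g l)) +
      snd c * (\<Sum>l\<le>N. (-1) ^ l * real (N choose l) * g l)"
    by (simp only: sum.distrib sum_distrib_left)
  also have "\<dots> = (if length cs = N then (-1) ^ N * fact N * (\<Prod>c\<leftarrow>cs. fst c) else 0)"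
    unfolding 1 2 by (simp add: cs N algebra_simps)
  finally show ?case .
qed

lemma falling_linear_factors: "falling n k = (\<Prod>t\<leftarrow>[0..<k]. real n - real t)"
  by (induction k) (simp_all add: falling_def)

lemma alternating_sum_falling:
  assumes "k \<le> e"
  shows "(\<Sum>l\<le>2 * e. (-1) ^ l * real (2 * e choose l) * (falling (i + (2 * e - l)) k * falling (j + l) k)) =
    (if k = e then (-1) ^ e * fact (2 * e) else 0)"
proof -
  \<comment> \<open>As functions of l, the two falling factorials contribute k factors of slope -1
    and k factors of slope 1, hence degree 2k and leading coefficient (-1)^k.\<close>
  define cs where "cs = map (\<lambda>t. (-1 :: real, real i + real (2 * e) - real t)) [0..<k] @
    map (\<lambda>t. (1 :: real, real j - real t)) [0..<k]"
  have "(\<Prod>c\<leftarrow>cs. fst c * real l + snd c) = falling (i + (2 * e - l)) k * falling (j + l) k"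
    if "l \<le> 2 * e" for l
    using that unfolding cs_def falling_linear_factors
    by (simp add: comp_def of_nat_diff algebra_simps)
  then have "(\<Sum>l\<le>2 * e. (-1) ^ l * real (2 * e choose l) * (falling (i + (2 * e - l)) k * falling (j + l) k)) =
    (\<Sum>l\<le>2 * e. (-1) ^ l * real (2 * e choose l) * (\<Prod>c\<leftarrow>cs. fst c * real l + snd c))"
    by (intro sum.cong) auto
  also have "\<dots> = (if length cs = 2 * e then (-1) ^ (2 * e) * fact (2 * e) * (\<Prod>c\<leftarrow>cs. fst c) else 0)"
    by (rule alternating_sum_linear_factors) (use assms in \<open>simp add: cs_def\<close>)
  also have "(\<Prod>c\<leftarrow>cs. fst c) = (-1) ^ k"
    by (simp add: cs_def comp_def map_replicate_const)
  finally show ?thesis by (simp add: cs_def)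
qed

text \<open>The Hankel factor is constant along the antidiagonal and leaves the sum. For k = e its
  index i + j + 2e - 2k is i + j, and the normalisation of \<open>top_hankel\<close> cancels (-1)^e
  (2e)!.\<close>

lemma top_hankel_sobolev_term:
  assumes "hankel H" "k \<le> e"
  shows "top_hankel (sobolev_term k H) e i j = (if k = e then H i j else 0)"
proof -
  let ?s = "\<lambda>l. (-1) ^ l * real (2 * e choose l)"
  have "(\<Sum>l\<le>2 * e. ?s l * sobolev_term k H (i + (2 * e - l)) (j + l)) =
      (\<Sum>l\<le>2 * e. ?s l * (falling (i + (2 * e - l)) k * falling (j + l) k) * H 0 (i + j + 2 * e - 2 * k))"
    by (rule sum.cong) (simp_all add: sobolev_term_hankel[OF assms(1)] algebra_simps)
  also have "\<dots> = (if k = e then (-1) ^ e * fact (2 * e) else 0) * H 0 (i + j + 2 * e - 2 * k)"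
    by (simp only: sum_distrib_right[symmetric] alternating_sum_falling[OF assms(2)])
  finally show ?thesis
    unfolding top_hankel_entry using hankel_entry[OF assms(1), of i j]
    by (simp add: power_mult_distrib[symmetric])
qed

text \<open>At stage k the operator of order 2(d-k) sees only the highest remaining term, so the
  recursion strips the terms from index d downwards. In particular the decomposition is
  unique.\<close>

lemma residual_hankel_sobolev:
  assumes "\<And>k. hankel (H k)" "\<And>i j. M i j = (\<Sum>k\<le>d. sobolev_term k (H k) i j)" "k \<le> d"
  shows "residual M d k = (\<lambda>i j. \<Sum>k'\<le>d - k. sobolev_term k' (H k') i j)"
    and "extracted M d k = H (d - k)"
proof -
  have top: "top_hankel (\<lambda>i j. \<Sum>k'\<le>e. sobolev_term k' (H k') i j) e = H e" for e
    by (intro ext) (simp add: top_hankel_sum top_hankel_sobolev_term[OF assms(1)])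
  show *: "residual M d k = (\<lambda>i j. \<Sum>k'\<le>d - k. sobolev_term k' (H k') i j)"
    using assms(3)
  proof (induction k)
    case (Suc k)
    then have IH: "residual M d k = (\<lambda>i j. \<Sum>k'\<le>d - k. sobolev_term k' (H k') i j)" by simp
    obtain e where e: "d - k = Suc e" "d - Suc k = e"
      using Suc.prems by (metis Suc_diff_Suc Suc_le_lessD)
    show ?case
      using top[of "Suc e"] unfolding residual.simps IH e by simp
  qed (use assms(2) in auto)
  show "extracted M d k = H (d - k)"
    unfolding extracted_def * by (rule top)
qed

section \<open>Hankel determinants and orthogonal polynomials\<close>

definition mfun :: "(nat \<Rightarrow> real) \<Rightarrow> real poly \<Rightarrow> real" where
  "mfun h p = (\<Sum>i\<le>degree p. coeff p i * h i)"

text \<open>A condition on coefficients, so that the zero polynomial satisfies it for every n,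
  including n = 0.\<close>

definition deg_lt :: "nat \<Rightarrow> real poly \<Rightarrow> bool" where
  "deg_lt n p \<longleftrightarrow> (\<forall>i\<ge>n. coeff p i = 0)"

lemma deg_lt_iff: "deg_lt n p \<longleftrightarrow> p = 0 \<or> degree p < n"
proof
  assume "deg_lt n p"
  then show "p = 0 \<or> degree p < n"
    unfolding deg_lt_def by (metis leading_coeff_0_iff not_le)
qed (auto simp: deg_lt_def coeff_eq_0)

lemma deg_lt_mono: "deg_lt n p \<Longrightarrow> n \<le> m \<Longrightarrow> deg_lt m p"
  by (auto simp: deg_lt_def)

lemma deg_lt_mult:
  assumes "deg_lt (Suc a) p" "deg_lt b q"
  shows "deg_lt (a + b) (p * q)"
proof (cases "p = 0 \<or> q = 0")
  case False
  then have "degree p \<le> a" "degree q < b" using assms by (auto simp: deg_lt_iff)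
  then have "degree (p * q) < a + b" using degree_mult_le[of p q] by linarith
  then show ?thesis by (simp add: deg_lt_iff)
qed (auto simp: deg_lt_def)

lemma deg_lt_div:
  assumes "degree P = m" "P \<noteq> 0" "deg_lt (m + k) p"
  shows "deg_lt k (p div P)"
proof (cases "p div P = 0")
  case False
  have "deg_lt m (p mod P)" using degree_mod_less[of P p] assms(1,2) by (auto simp: deg_lt_iff)
  then have "deg_lt (m + k) (p - p mod P)" using assms(3) by (auto simp: deg_lt_def)
  moreover have "p - p mod P = P * (p div P)" by (simp add: minus_mod_eq_mult_div)
  ultimately have "degree (P * (p div P)) < m + k" using False assms(2) by (simp add: deg_lt_iff)
  then show ?thesis using False assms(1,2) by (simp add: degree_mult_eq deg_lt_iff)
qed (simp add: deg_lt_def)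

lemma deg_lt_reduce:
  assumes "deg_lt (Suc n) s" "deg_lt (Suc n) P" "coeff P n = 1"
  shows "deg_lt n (s - Polynomial.smult (coeff s n) P)"
  unfolding deg_lt_def
proof (intro allI impI)
  fix i assume "n \<le> i"
  then show "coeff (s - Polynomial.smult (coeff s n) P) i = 0"
    using assms by (cases "i = n") (auto simp: deg_lt_def)
qed

lemma mfun_eq: "degree p \<le> n \<Longrightarrow> mfun h p = (\<Sum>i\<le>n. coeff p i * h i)"
  unfolding mfun_def by (rule sum.mono_neutral_left) (auto simp: coeff_eq_0)

lemma mfun_0 [simp]: "mfun h 0 = 0"
  by (simp add: mfun_def)

lemma mfun_add [simp]: "mfun h (p + q) = mfun h p + mfun h q"
proof -
  let ?n = "max (degree p) (degree q)"
  show ?thesis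
    using mfun_eq[of p ?n h] mfun_eq[of q ?n h] mfun_eq[of "p + q" ?n h] degree_add_le_max[of p q]
    by (simp add: sum.distrib algebra_simps)
qed

lemma mfun_smult [simp]: "mfun h (Polynomial.smult c p) = c * mfun h p"
  using mfun_eq[of "Polynomial.smult c p" "degree p" h]
  by (simp add: mfun_def sum_distrib_left mult.assoc)

lemma mfun_diff [simp]: "mfun h (p - q) = mfun h p - mfun h q"
proof -
  have "p - q = p + Polynomial.smult (-1) q" by simp
  then show ?thesis by (simp only: mfun_add mfun_smult)
qed

lemma mfun_sum [simp]: "mfun h (\<Sum>i\<in>S. f i) = (\<Sum>i\<in>S. mfun h (f i))"
  by (induction S rule: infinite_finite_induct) auto

lemma mfun_monom [simp]: "mfun h (monom c n) = c * h n"
proof -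
  have "mfun h (monom c n) = (\<Sum>i\<le>n. if i = n then c * h n else 0)"
    unfolding mfun_eq[OF degree_monom_le] by (rule sum.cong) auto
  then show ?thesis by simp
qed

lemma mfun_1: "mfun h 1 = h 0"
  using mfun_monom[of h 1 0] by (simp add: monom_0 one_pCons)

lemma mult_eq_sum_monom:
  assumes "deg_lt n q"
  shows "q * (p :: real poly) = (\<Sum>i<n. Polynomial.smult (coeff q i) (p * monom 1 i))"
proof -
  have "q = (\<Sum>i<n. monom (coeff q i) i)"
    using assms by (intro poly_eqI) (auto simp: coeff_sum deg_lt_def)
  then have "q * p = (\<Sum>i<n. monom (coeff q i) i * p)"
    by (metis sum_distrib_right)
  also have "\<dots> = (\<Sum>i<n. Polynomial.smult (coeff q i) (p * monom 1 i))"
  proof (rule sum.cong)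
    fix i
    have "monom (coeff q i) i = Polynomial.smult (coeff q i) (monom 1 i)"
      by (simp add: smult_monom)
    then show "monom (coeff q i) i * p = Polynomial.smult (coeff q i) (p * monom 1 i)"
      by (simp add: mult.commute)
  qed simp
  finally show ?thesis .
qed

lemma mfun_mult_monom:
  "deg_lt n q \<Longrightarrow> mfun h (q * monom 1 j) = (\<Sum>i<n. coeff q i * h (i + j))"
  by (simp add: mult_eq_sum_monom mult_monom add.commute)

lemma mfun_orth:
  assumes "\<And>j. j < n \<Longrightarrow> mfun h (p * monom 1 j) = 0" "deg_lt n r"
  shows "mfun h (p * r) = 0"
proof -
  have "mfun h (p * r) = mfun h (r * p)" by (simp add: mult.commute)
  also have "\<dots> = 0" unfolding mult_eq_sum_monom[OF assms(2)] by (simp add: assms(1))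
  finally show ?thesis .
qed

section \<open>Positive definite functionals and orthogonal projection\<close>

definition posdef :: "(nat \<Rightarrow> real) \<Rightarrow> nat \<Rightarrow> bool" where
  "posdef h n \<longleftrightarrow> (\<forall>q. q \<noteq> 0 \<and> deg_lt n q \<longrightarrow> mfun h (q * q) > 0)"

lemma posdef_mono: "posdef h n \<Longrightarrow> m \<le> n \<Longrightarrow> posdef h m"
  by (meson deg_lt_mono posdef_def)

lemma posdef_0_pos:
  assumes "posdef h n" "n > 0"
  shows "h 0 > 0"
proof -
  have "deg_lt n (1 :: real poly)" using assms(2) by (simp add: deg_lt_iff)
  then show ?thesis using assms(1)[unfolded posdef_def, rule_format, of 1] by (simp add: mfun_1)
qed

text \<open>Gram-Schmidt: projecting x^n gives a monic P orthogonal to all lower degrees, and every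
  polynomial of degree at most n is a multiple of P plus one of lower degree.\<close>

lemma orthogonal_projection:
  assumes "posdef h n"
  shows "\<exists>r. deg_lt n r \<and> (\<forall>s. deg_lt n s \<longrightarrow> mfun h ((f - r) * s) = 0)"
  using assms
proof (induction n arbitrary: f)
  case 0
  then show ?case by (intro exI[of _ 0]) (auto simp: deg_lt_iff)
next
  case (Suc n)
  then have IH: "\<And>f. \<exists>r. deg_lt n r \<and> (\<forall>s. deg_lt n s \<longrightarrow> mfun h ((f - r) * s) = 0)"
    using posdef_mono[OF Suc.prems] by simp
  obtain r1 where r1: "deg_lt n r1" "\<And>s. deg_lt n s \<Longrightarrow> mfun h ((f - r1) * s) = 0"
    using IH[of f] by auto
  obtain r2 where r2: "deg_lt n r2" "\<And>s. deg_lt n s \<Longrightarrow> mfun h ((monom 1 n - r2) * s) = 0"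
    using IH[of "monom 1 n"] by auto
  define P where "P = monom 1 n - r2"
  have P: "deg_lt (Suc n) P" "coeff P n = 1"
    using r2(1) by (auto simp: deg_lt_def P_def)
  then have PP: "mfun h (P * P) > 0"
    using Suc.prems by (metis coeff_0 posdef_def zero_neq_one)
  \<comment> \<open>The Fourier coefficient along P, which makes f - r orthogonal to P as
    well.\<close>
  define c where "c = mfun h ((f - r1) * P) / mfun h (P * P)"
  define r where "r = r1 + Polynomial.smult c P"
  have "deg_lt (Suc n) r"
    using r1(1) P(1) by (auto simp: r_def deg_lt_def)
  moreover have "mfun h ((f - r) * s) = 0" if s: "deg_lt (Suc n) s" for s
  proof -
    define t where "t = s - Polynomial.smult (coeff s n) P"
    have t: "deg_lt n t" unfolding t_def by (rule deg_lt_reduce[OF s P])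
    have s: "s = t + Polynomial.smult (coeff s n) P" by (simp add: t_def)
    have "(f - r) * s = (f - r1) * t - Polynomial.smult c (P * t) +
        Polynomial.smult (coeff s n) ((f - r1) * P - Polynomial.smult c (P * P))"
      by (subst s) (simp add: r_def algebra_simps smult_add_right smult_diff_right)
    then have "mfun h ((f - r) * s) = coeff s n * (mfun h ((f - r1) * P) - c * mfun h (P * P))"
      using r1(2)[OF t] r2(2)[OF t] by (simp flip: P_def)
    then show ?thesis using PP by (simp add: c_def)
  qed
  ultimately show ?case by blast
qed

definition orth_poly :: "(nat \<Rightarrow> real) \<Rightarrow> nat \<Rightarrow> real poly \<Rightarrow> bool" where
  "orth_poly h n P \<longleftrightarrow> deg_lt (Suc n) P \<and> coeff P n = 1 \<and> (\<forall>s. deg_lt n s \<longrightarrow> mfun h (P * s) = 0)"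

lemma orth_poly_exists:
  assumes "posdef h n" obtains P where "orth_poly h n P"
proof -
  obtain r where "deg_lt n r" "\<And>s. deg_lt n s \<Longrightarrow> mfun h ((monom 1 n - r) * s) = 0"
    using orthogonal_projection[OF assms, of "monom 1 n"] by auto
  then have "orth_poly h n (monom 1 n - r)" by (auto simp: orth_poly_def deg_lt_def)
  then show ?thesis by (rule that)
qed

lemma degree_orth_poly: "orth_poly h n P \<Longrightarrow> degree P = n \<and> P \<noteq> 0"
  unfolding orth_poly_def
  by (metis coeff_0 deg_lt_iff le_degree less_Suc_eq_le order_antisym zero_neq_one)

section \<open>Hankel determinants and Sylvester's criterion\<close>

abbreviation hdet :: "(nat \<Rightarrow> real) \<Rightarrow> nat \<Rightarrow> real" where
  "hdet h n \<equiv> Determinant.det (leading_section (\<lambda>i j. h (i + j)) n)"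

text \<open>A kernel vector is read as the coefficient vector of q; entry j of its image under the
  Hankel matrix is then the value of the functional at q x^j.\<close>

lemma hdet_eq_0_iff:
  "hdet h n = 0 \<longleftrightarrow> (\<exists>q. q \<noteq> 0 \<and> deg_lt n q \<and> (\<forall>j<n. mfun h (q * monom 1 j) = 0))"
proof -
  let ?A = "leading_section (\<lambda>i j. h (i + j)) n"
  have A: "?A \<in> carrier_mat n n" by (simp add: leading_section_def)
  have Av: "(?A *\<^sub>v v) $ j = (\<Sum>i<n. v $ i * h (i + j))" if "v \<in> carrier_vec n" "j < n" for v j
    using that by (simp add: leading_section_def scalar_prod_def lessThan_atLeast0 algebra_simps)
  show ?thesis
    unfolding det_0_iff_vec_prod_zero[OF A]
  proof safe
    fix v assume v: "v \<in> carrier_vec n" "v \<noteq> 0\<^sub>v n" "?A *\<^sub>v v = 0\<^sub>v n"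
    define q where "q = (\<Sum>i<n. monom (v $ i) i)"
    have c: "coeff q i = (if i < n then v $ i else 0)" for i
      by (simp add: q_def coeff_sum)
    obtain i where "i < n" "v $ i \<noteq> 0" using v(1,2) by (metis eq_vecI carrier_vecD index_zero_vec)
    then have "q \<noteq> 0" using c[of i] by auto
    moreover have d: "deg_lt n q" by (simp add: deg_lt_def c)
    moreover have "mfun h (q * monom 1 j) = 0" if "j < n" for j
      using Av[OF v(1) that] v(3) that by (simp add: mfun_mult_monom[OF d] c)
    ultimately show "\<exists>q. q \<noteq> 0 \<and> deg_lt n q \<and> (\<forall>j<n. mfun h (q * monom 1 j) = 0)" by blast
  next
    fix q assume q: "q \<noteq> 0" "deg_lt n q" "\<forall>j<n. mfun h (q * monom 1 j) = 0"
    define v where "v = Matrix.vec n (coeff q)"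
    have "degree q < n" using q by (auto simp: deg_lt_iff)
    then have "v $ degree q \<noteq> 0" "degree q < n" using q(1) by (auto simp: v_def)
    then have "v \<noteq> 0\<^sub>v n" by auto
    moreover have v: "v \<in> carrier_vec n" by (simp add: v_def)
    moreover have "?A *\<^sub>v v = 0\<^sub>v n"
    proof (rule eq_vecI)
      fix j assume "j < dim_vec (0\<^sub>v n :: real Matrix.vec)"
      then have j: "j < n" by simp
      have "(?A *\<^sub>v v) $ j = (\<Sum>i<n. coeff q i * h (i + j))"
        unfolding Av[OF v j] by (rule sum.cong) (simp_all add: v_def)
      then show "(?A *\<^sub>v v) $ j = 0\<^sub>v n $ j"
        using q(3) j by (simp add: mfun_mult_monom[OF q(2)])
    qed (simp add: leading_section_def)
    ultimately show "\<exists>v. v \<in> carrier_vec n \<and> v \<noteq> 0\<^sub>v n \<and> ?A *\<^sub>v v = 0\<^sub>v n" by blast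
  qed
qed

text \<open>Replacing the last row of the Hankel matrix by the combination of all rows with the coefficients
  of \<open>P\<close> leaves a row whose only nonzero entry is the last one.\<close>

lemma hdet_Suc:
  assumes "orth_poly h n P"
  shows "hdet h (Suc n) = hdet h n * mfun h (P * P)"
proof -
  let ?A = "leading_section (\<lambda>i j. h (i + j)) (Suc n)"
  define T where "T = Matrix.mat (Suc n) (Suc n)
    (\<lambda>(i, j). if i < n then (if i = j then 1 else 0) else coeff P j)"
  define B where "B = Matrix.mat (Suc n) (Suc n)
    (\<lambda>(i, j). if i < n then h (i + j) else mfun h (P * monom 1 j))"
  have P: "deg_lt (Suc n) P" "coeff P n = 1" "\<And>s. deg_lt n s \<Longrightarrow> mfun h (P * s) = 0"
    using assms by (auto simp: orth_poly_def)
  have A: "?A \<in> carrier_mat (Suc n) (Suc n)" by (simp add: leading_section_def)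
  have T: "T \<in> carrier_mat (Suc n) (Suc n)" by (simp add: T_def)
  have B: "B \<in> carrier_mat (Suc n) (Suc n)" by (simp add: B_def)
  have "Determinant.det T = prod_list (diag_mat T)"
    by (rule det_lower_triangular[OF _ T]) (auto simp: T_def)
  also have "diag_mat T = map (\<lambda>i. 1) [0..<Suc n]"
    unfolding diag_mat_def using T P(2) by (intro map_cong) (auto simp: T_def)
  also have "prod_list \<dots> = 1" by (simp add: map_replicate_const)
  finally have detT: "Determinant.det T = 1" .
  have TA: "T * ?A = B"
  proof (rule eq_matI)
    fix i j assume "i < dim_row B" "j < dim_col B"
    then have ij: "i < Suc n" "j < Suc n" by (auto simp: B_def)
    then have *: "(T * ?A) $$ (i, j) = (\<Sum>k<Suc n. T $$ (i, k) * h (k + j))"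
      by (simp add: T_def leading_section_def scalar_prod_def lessThan_atLeast0)
    show "(T * ?A) $$ (i, j) = B $$ (i, j)"
    proof (cases "i < n")
      case True
      have "(\<Sum>k<Suc n. T $$ (i, k) * h (k + j)) = (\<Sum>k<Suc n. if k = i then h (k + j) else 0)"
        using ij True by (intro sum.cong) (auto simp: T_def)
      then show ?thesis using True ij unfolding * by (simp add: B_def)
    next
      case False
      have "(\<Sum>k<Suc n. T $$ (i, k) * h (k + j)) = (\<Sum>k<Suc n. coeff P k * h (k + j))"
        using ij False by (intro sum.cong) (auto simp: T_def)
      then show ?thesis using False ij unfolding * mfun_mult_monom[OF P(1), symmetric] by (simp add: B_def)
    qed
  qed (simp_all add: T_def B_def leading_section_def)
  have "hdet h (Suc n) = Determinant.det (T * ?A)"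
    by (simp add: det_mult[OF T A] detT)
  also have "\<dots> = (\<Sum>j<Suc n. B $$ (n, j) * cofactor B n j)"
    unfolding TA by (rule laplace_expansion_row[OF B]) simp
  also have "\<dots> = B $$ (n, n) * cofactor B n n"
    unfolding sum.lessThan_Suc by (simp add: B_def P(3) deg_lt_def)
  also have "cofactor B n n = hdet h n"
  proof -
    have "mat_delete B n n = leading_section (\<lambda>i j. h (i + j)) n"
      by (rule eq_matI) (auto simp: mat_delete_def B_def leading_section_def)
    then show ?thesis by (simp add: cofactor_def)
  qed
  also have "B $$ (n, n) = mfun h (P * monom 1 n)" by (simp add: B_def)
  \<comment> \<open>P is monic, so x^n - P has degree below n and P is orthogonal to it.\<close>
  also have "\<dots> = mfun h (P * P)"
    using P(3)[OF deg_lt_reduce[of n "monom 1 n" P]] P(1,2)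
    by (simp add: algebra_simps deg_lt_def)
  finally show ?thesis by simp
qed

text \<open>Sylvester's criterion for Hankel matrices. By \<open>hdet_Suc\<close> the sign of the
  next determinant is that of the value at P^2, and writing q = c P + r with r orthogonal to P makes
  the value at q^2 the sum of c^2 times that value and the value at r^2.\<close>

lemma posdef_iff_hdet: "posdef h n \<longleftrightarrow> (\<forall>k. 1 \<le> k \<and> k \<le> n \<longrightarrow> hdet h k > 0)"
proof (induction n)
  case 0
  then show ?case by (auto simp: posdef_def deg_lt_iff)
next
  case (Suc n)
  have "posdef h (Suc n) \<longleftrightarrow> posdef h n \<and> hdet h (Suc n) > 0"
  proof (cases "posdef h n")
    case True
    then obtain P where P: "orth_poly h n P" by (rule orth_poly_exists)
    \<comment> \<open>For n = 0 this is the empty determinant, which is 1.\<close>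
    have Dn: "hdet h n > 0"
      using True Suc.IH by (cases "n = 0") (auto simp: leading_section_def)
    have "posdef h (Suc n) \<longleftrightarrow> mfun h (P * P) > 0"
    proof
      assume "posdef h (Suc n)"
      then show "mfun h (P * P) > 0"
        using P degree_orth_poly[OF P] by (auto simp: posdef_def orth_poly_def)
    next
      assume PP: "mfun h (P * P) > 0"
      show "posdef h (Suc n)"
        unfolding posdef_def
      proof (intro allI impI)
        fix q assume q: "q \<noteq> 0 \<and> deg_lt (Suc n) q"
        define r where "r = q - Polynomial.smult (coeff q n) P"
        have r: "deg_lt n r"
          unfolding r_def using P q by (intro deg_lt_reduce) (auto simp: orth_poly_def)
        have "q * q = Polynomial.smult (coeff q n ^ 2) (P * P) + Polynomial.smult (2 * coeff q n) (P * r) + r * r"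
          unfolding r_def
          by (simp add: algebra_simps smult_add_right smult_diff_right power2_eq_square flip: smult_add_left)
        then have *: "mfun h (q * q) = coeff q n ^ 2 * mfun h (P * P) + mfun h (r * r)"
          using P r by (simp add: orth_poly_def)
        show "mfun h (q * q) > 0"
        proof (cases "r = 0")
          case True
          then have "coeff q n \<noteq> 0" using q by (auto simp: r_def)
          then show ?thesis using * True PP by simp
        next
          case False
          then have "mfun h (r * r) > 0" using \<open>posdef h n\<close> r by (auto simp: posdef_def)
          then show ?thesis using * PP by (simp add: add_nonneg_pos)
        qed
      qed
    qed
    then show ?thesis using hdet_Suc[OF P] Dn True by (simp add: zero_less_mult_iff)
  qed (use posdef_mono[of h "Suc n" n] in auto)
  then show ?case using Suc.IH by (auto simp: le_Suc_eq)
qed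

lemma pos_def_inf_iff: "pos_def_inf (\<lambda>i j. h (i + j)) \<longleftrightarrow> (\<forall>n. posdef h n)"
  unfolding pos_def_inf_def posdef_iff_hdet by auto

text \<open>If \<open>J\<close> were the least index at which \<open>P\<close> fails to be orthogonal to the monomials, then a kernel
  vector of the singular Hankel matrix of size \<open>J + 1\<close> would be a multiple \<open>P u\<close>, and testing it against
  \<open>x\<^sup>J\<^sup>-\<^sup>e\<close> with \<open>e = deg u\<close> would isolate that nonzero value.\<close>

lemma pos_def_order_annihilator:
  assumes "pos_def_order m (\<lambda>i j. h (i + j))"
  obtains P where "orth_poly h m P" "\<And>r. mfun h (P * r) = 0"
proof -
  have pd: "posdef h m" and z: "\<And>n. n > m \<Longrightarrow> hdet h n = 0"
    using assms by (auto simp: pos_def_order_def posdef_iff_hdet)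
  obtain P where P: "orth_poly h m P" using pd by (rule orth_poly_exists)
  have dP: "degree P = m" "P \<noteq> 0" using degree_orth_poly[OF P] by auto
  have *: "mfun h (P * monom 1 j) = 0" for j
  proof (rule ccontr)
    assume "mfun h (P * monom 1 j) \<noteq> 0"
    then obtain J where J: "mfun h (P * monom 1 J) \<noteq> 0" "\<And>j. j < J \<Longrightarrow> mfun h (P * monom 1 j) = 0"
      using exists_least_iff[of "\<lambda>j. mfun h (P * monom 1 j) \<noteq> 0"] by auto
    have orthJ: "mfun h (P * s) = 0" if "deg_lt J s" for s
      using J(2) that by (rule mfun_orth)
    have "m \<le> J"
      using P J(1) by (metis deg_lt_def coeff_monom linorder_not_le orth_poly_def order_less_le_trans less_irrefl)
    then have "hdet h (Suc J) = 0" by (intro z) simp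
    then obtain q where q: "q \<noteq> 0" "deg_lt (Suc J) q" "\<And>j. j < Suc J \<Longrightarrow> mfun h (q * monom 1 j) = 0"
      unfolding hdet_eq_0_iff by auto
    have orthq: "mfun h (q * s) = 0" if "deg_lt (Suc J) s" for s
      using q(3) that by (rule mfun_orth)
    define u where "u = q div P"
    define r where "r = q mod P"
    have qur: "q = P * u + r" by (simp add: u_def r_def)
    have r: "deg_lt m r"
      using degree_mod_less[of P q] dP by (auto simp: r_def deg_lt_iff)
    have u: "deg_lt (Suc (J - m)) u"
      unfolding u_def using deg_lt_div[of P m "Suc (J - m)" q] dP q(2) \<open>m \<le> J\<close> by simp
    \<comment> \<open>The product u r has degree below J, so \<open>P * (u * r)\<close> is
      annihilated; testing q against r then leaves only the value at r^2, which positivity below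
      degree m forbids unless r = 0.\<close>
    have "r = 0"
    proof (rule ccontr)
      assume "r \<noteq> 0"
      then have pos: "mfun h (r * r) > 0" using pd r by (auto simp: posdef_def)
      have "deg_lt J (u * r)" using deg_lt_mult[OF u r] \<open>m \<le> J\<close> by simp
      then have "mfun h (P * (u * r)) = 0" by (rule orthJ)
      moreover have "mfun h (q * r) = 0" using r \<open>m \<le> J\<close> by (intro orthq) (auto intro: deg_lt_mono)
      moreover have "q * r = P * (u * r) + r * r" by (simp add: qur algebra_simps)
      ultimately show False using pos by simp
    qed
    then have qPu: "q = P * u" using qur by simp
    then have "u \<noteq> 0" using q(1) by auto
    define e where "e = degree u"
    have e: "e \<le> J" "coeff u e \<noteq> 0"
      using u \<open>u \<noteq> 0\<close> by (auto simp: deg_lt_iff e_def)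
    define t where "t = u * monom 1 (J - e) - monom (coeff u e) J"
    have t: "deg_lt J t"
      unfolding deg_lt_def
    proof (intro allI impI)
      fix i assume "J \<le> i"
      then show "coeff t i = 0"
        using e by (cases "i = J") (auto simp: t_def e_def coeff_monom_mult coeff_eq_0 mult.commute[of u])
    qed
    have "mfun h (q * monom 1 (J - e)) = 0" by (rule q(3)) simp
    moreover have "q * monom 1 (J - e) = P * t + Polynomial.smult (coeff u e) (P * monom 1 J)"
    proof -
      have "monom (coeff u e) J = Polynomial.smult (coeff u e) (monom 1 J)" by (simp add: smult_monom)
      then show ?thesis by (simp add: t_def qPu algebra_simps)
    qed
    ultimately have "coeff u e * mfun h (P * monom 1 J) = 0" using orthJ[OF t] by simp
    then show False using e(2) J(1) by simp
  qed
  have "mfun h (P * r) = 0" for r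
    by (rule mfun_orth[of "Suc (degree r)"]) (auto simp: * deg_lt_iff)
  then show ?thesis using P that by blast
qed

section \<open>Gauss quadrature\<close>

lemma prod_linear_dvd:
  fixes p :: "real poly"
  assumes "finite X" "\<And>x. x \<in> X \<Longrightarrow> poly p x = 0"
  shows "(\<Prod>x\<in>X. [:-x, 1:]) dvd p"
  using assms
proof (induction X arbitrary: p)
  case (insert x X)
  then obtain q where q: "p = [:-x, 1:] * q" by (metis dvdE insertI1 poly_eq_0_iff_dvd)
  have "poly q y = 0" if "y \<in> X" for y
    using insert.prems[of y] insert.hyps that by (auto simp: q)
  then show ?case using insert.IH[of q] insert.hyps by (simp add: q mult_dvd_mono del: mult_pCons_left)
qed simp

text \<open>The quadratic is (x - z)(x - cnj z). The remainder a + b x has real coefficients and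
  vanishes at z; its imaginary part gives b = 0, and then a = 0.\<close>

lemma quadratic_dvd_of_nonreal_root:
  fixes R :: "real poly"
  assumes "poly (map_poly complex_of_real R) z = 0" "Im z \<noteq> 0"
  shows "[:Re z ^ 2 + Im z ^ 2, - 2 * Re z, 1:] dvd R"
proof -
  let ?c = "map_poly complex_of_real"
  let ?Q = "[:Re z ^ 2 + Im z ^ 2, - 2 * Re z, 1:]"
  define S where "S = R mod ?Q"
  have "degree S < 2 \<or> S = 0" using degree_mod_less[of ?Q R] by (auto simp: S_def)
  then have "degree S \<le> 1" by auto
  then have "S = [:coeff S 0, coeff S 1:]"
    by (intro poly_eqI) (auto simp: coeff_pCons coeff_eq_0 split: nat.split)
  then obtain a b where S: "S = [:a, b:]" by blast
  have "R = ?Q * (R div ?Q) + S" unfolding S_def by (simp only: mult_div_mod_eq)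
  moreover have "?c (p * q) = ?c p * ?c q" "?c (p + q) = ?c p + ?c q" for p q
    by (intro poly_eqI; simp add: coeff_map_poly coeff_mult)+
  ultimately have "poly (?c R) z = poly (?c ?Q) z * poly (?c (R div ?Q)) z + poly (?c S) z"
    by (metis poly_add poly_mult)
  moreover have "poly (?c ?Q) z = 0"
    by (simp add: map_poly_pCons complex_eq_iff power2_eq_square algebra_simps)
  ultimately have "complex_of_real a + z * complex_of_real b = 0"
    using assms(1) by (simp add: S map_poly_pCons)
  then have "b = 0" "a = 0" using assms(2) by (auto simp: complex_eq_iff)
  then have "S = 0" by (simp add: S)
  then show ?thesis by (simp add: S_def mod_eq_0_iff_dvd)
qed

text \<open>A double or nonreal root gives a factorisation \<open>P = ((x - a)\<^sup>2 + b\<^sup>2) B\<close>, and then \<open>P B\<close> is a sum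
  of squares although \<open>P\<close> is orthogonal to \<open>B\<close>.\<close>

lemma card_roots_orth:
  assumes "posdef h n" "orth_poly h n P"
  shows "card {x. poly P x = 0} = n"
proof -
  define X where "X = {x. poly P x = 0}"
  have dP: "degree P = n" "P \<noteq> 0" using degree_orth_poly[OF assms(2)] by auto
  then have fin: "finite X" by (simp add: X_def poly_roots_finite)
  define Q where "Q = (\<Prod>x\<in>X. [:-x, 1:])"
  have dQ: "degree Q = card X" unfolding Q_def by (subst degree_prod_sum_eq) auto
  have "Q dvd P" unfolding Q_def by (rule prod_linear_dvd[OF fin]) (simp add: X_def)
  then obtain R where R: "P = Q * R" by blast
  then have nz: "Q \<noteq> 0" "R \<noteq> 0" using dP by auto
  \<comment> \<open>Each distinct real root has been divided out once, so a root of R is either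
    nonreal or a repeated real root of P.\<close>
  have "degree R = 0"
  proof (rule ccontr)
    assume "degree R \<noteq> 0"
    then have "\<not> constant (poly (map_poly complex_of_real R))"
      by (subst constant_degree) (simp add: degree_map_poly)
    then obtain z where z: "poly (map_poly complex_of_real R) z = 0"
      using fundamental_theorem_of_algebra by blast
    obtain a b B where ab: "P = [:a\<^sup>2 + b\<^sup>2, - 2 * a, 1:] * B"
    proof (cases "Im z = 0")
      case True
      define a where "a = Re z"
      have "z = of_real a" using True by (simp add: a_def complex_eq_iff)
      moreover have "poly (map_poly complex_of_real p) (of_real a) = of_real (poly p a)" for p
        by (induction p) (auto simp: map_poly_pCons)
      ultimately have Ra: "poly R a = 0" using z by simp
      then have "a \<in> X" by (simp add: X_def R)
      then have "Q = [:-a, 1:] * (\<Prod>x\<in>X - {a}. [:-x, 1:])"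
        unfolding Q_def using fin by (simp add: prod.remove)
      moreover obtain S where "R = [:-a, 1:] * S" using Ra by (metis dvdE poly_eq_0_iff_dvd)
      moreover have "[:-a, 1:] * [:-a, 1:] = [:a\<^sup>2 + 0\<^sup>2, - 2 * a, 1:]"
        by (simp add: power2_eq_square)
      ultimately have "P = [:a\<^sup>2 + 0\<^sup>2, - 2 * a, 1:] * ((\<Prod>x\<in>X - {a}. [:-x, 1:]) * S)"
        unfolding R by (metis mult.assoc mult.left_commute)
      then show ?thesis by (rule that)
    next
      case False
      have "[:Re z ^ 2 + Im z ^ 2, - 2 * Re z, 1:] dvd P"
        unfolding R using quadratic_dvd_of_nonreal_root[OF z False] by (rule dvd_mult)
      then show ?thesis using that by (auto elim: dvdE)
    qed
    have "B \<noteq> 0" using ab dP by auto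
    then have "degree P = 2 + degree B" unfolding ab by (subst degree_mult_eq) auto
    then have "degree B + 2 = n" using dP by simp
    then have B: "deg_lt n ([:-a, 1:] * B)" "deg_lt n B"
      using degree_mult_le[of "[:-a, 1:]" B] by (auto simp: deg_lt_iff simp del: mult_pCons_left)
    define E where "E = [:-a, 1:] * B"
    have E: "deg_lt n E" unfolding E_def by (rule B(1))
    have "E \<noteq> 0" using \<open>B \<noteq> 0\<close> by (simp add: E_def del: mult_pCons_left)
    have PB: "P * B = E * E + Polynomial.smult (b\<^sup>2) (B * B)"
    proof -
      have 1: "[:a\<^sup>2 + b\<^sup>2, - 2 * a, 1:] = [:-a, 1:] * [:-a, 1:] + [:b\<^sup>2:]"
        by (simp add: power2_eq_square)
      have 2: "(l * l + c) * B * B = (l * B) * (l * B) + c * (B * B)" for l c :: "real poly"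
        by (simp only: algebra_simps)
      show ?thesis unfolding ab 1 2 E_def by simp
    qed
    have "mfun h (E * E) > 0" "mfun h (B * B) > 0"
      using assms(1) E \<open>E \<noteq> 0\<close> B(2) \<open>B \<noteq> 0\<close> by (auto simp: posdef_def)
    then have "mfun h (P * B) > 0" by (simp add: PB add_pos_nonneg)
    then show False using assms(2) B(2) by (simp add: orth_poly_def)
  qed
  then have "degree P = card X" using degree_mult_eq[OF nz] dQ by (simp add: R)
  then show ?thesis using dP by (simp add: X_def)
qed

text \<open>The nodes are the n zeros of P, and the weights are the values of the functional at the
  Lagrange polynomials. Interpolation reproduces \<open>p mod P\<close>, so the formula is exact
  once the multiple \<open>P * (p div P)\<close> is annihilated. This form of the condition covers
  both degrees below 2n, by orthogonality, and every p when P annihilates the functional.\<close>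

lemma gauss_quadrature:
  assumes "posdef h n" "orth_poly h n P"
  obtains X w where "finite X" "card X = n" "\<And>x. x \<in> X \<Longrightarrow> w x > 0"
    "\<And>p. mfun h (P * (p div P)) = 0 \<Longrightarrow> mfun h p = (\<Sum>x\<in>X. w x * poly p x)"
proof -
  define X where "X = {x. poly P x = 0}"
  have dP: "degree P = n" "P \<noteq> 0" using degree_orth_poly[OF assms(2)] by auto
  have fin: "finite X" using dP by (simp add: X_def poly_roots_finite)
  have card: "card X = n" using card_roots_orth[OF assms] by (simp add: X_def)
  have vanish: "r = 0" if "deg_lt n r" "\<And>x. x \<in> X \<Longrightarrow> poly r x = 0" for r
  proof (rule ccontr)
    assume "r \<noteq> 0"
    then have "card X \<le> degree r"
      using that(2) card_mono[OF poly_roots_finite, of r X] card_poly_roots_bound[of r] by force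
    then show False using that(1) \<open>r \<noteq> 0\<close> card by (simp add: deg_lt_iff)
  qed
  have mod: "deg_lt n (p mod P)" "\<And>x. x \<in> X \<Longrightarrow> poly (p mod P) x = poly p x" for p
  proof -
    show "deg_lt n (p mod P)" using degree_mod_less[of P p] dP by (auto simp: deg_lt_iff)
    fix x assume "x \<in> X"
    then have "poly (P * (p div P) + p mod P) x = poly (p mod P) x"
      unfolding poly_add poly_mult by (simp add: X_def)
    then show "poly (p mod P) x = poly p x" by (simp only: mult_div_mod_eq)
  qed
  \<comment> \<open>The Lagrange basis polynomials of the nodes.\<close>
  define l where "l x = (\<Prod>y\<in>X - {x}. Polynomial.smult (1 / (x - y)) [:-y, 1:])" for x
  have l: "poly (l x) y = (if x = y then 1 else 0)" if "x \<in> X" "y \<in> X" for x y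
  proof (cases "x = y")
    case True
    have "poly (l x) x = (\<Prod>z\<in>X - {x}. poly (Polynomial.smult (1 / (x - z)) [:-z, 1:]) x)"
      by (simp only: l_def poly_prod)
    also have "\<dots> = 1"
    proof (rule prod.neutral, rule ballI)
      fix z assume "z \<in> X - {x}"
      then have "(x - z) / (x - z) = 1" by simp
      then show "poly (Polynomial.smult (1 / (x - z)) [:-z, 1:]) x = 1"
        by (simp only: diff_divide_distrib) simp
    qed
    finally show ?thesis using True by simp
  next
    case False
    then show ?thesis using that fin by (auto simp: l_def poly_prod)
  qed
  have dl: "deg_lt n (l x)" if "x \<in> X" for x
  proof -
    have "degree (l x) \<le> sum (degree \<circ> (\<lambda>y. Polynomial.smult (1 / (x - y)) [:-y, 1:])) (X - {x})"
      unfolding l_def by (rule degree_prod_sum_le) (simp add: fin)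
    also have "\<dots> \<le> (\<Sum>y\<in>X - {x}. 1)" by (intro sum_mono) simp
    also have "\<dots> = n - 1" using that fin card by simp
    finally have "degree (l x) \<le> n - 1" .
    moreover have "n > 0" using that fin card card_gt_0_iff by blast
    ultimately show ?thesis unfolding deg_lt_iff by linarith
  qed
  define w where "w x = mfun h (l x)" for x
  have "w x > 0" if x: "x \<in> X" for x
  proof -
    \<comment> \<open>A Lagrange polynomial takes only the values 0 and 1 on the nodes, so f is a
      multiple of P with quotient of degree below n. Hence the functional agrees on
      \<open>l x\<close> and its square, and the weight is positive.\<close>
    define f where "f = l x * l x - l x"
    have "poly f y = 0" if "y \<in> X" for y using l[OF x that] by (simp add: f_def)
    then have "f mod P = 0" by (intro vanish mod) (simp add: mod)
    then have f: "f = P * (f div P)" by (metis add.right_neutral mult_div_mod_eq)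
    have "deg_lt (n + n) f"
      using deg_lt_mult[of n "l x" n "l x"] dl[OF x] deg_lt_mono[OF dl[OF x]]
      by (simp add: f_def deg_lt_def)
    then have "deg_lt n (f div P)" using deg_lt_div dP by blast
    then have "mfun h f = 0" using f assms(2) by (metis orth_poly_def)
    then have "w x = mfun h (l x * l x)" by (simp add: w_def f_def)
    moreover have "l x \<noteq> 0" using l[OF x x] by auto
    ultimately show ?thesis using assms(1) dl[OF x] by (simp add: posdef_def)
  qed
  moreover have "mfun h p = (\<Sum>x\<in>X. w x * poly p x)" if "mfun h (P * (p div P)) = 0" for p
  proof -
    \<comment> \<open>The interpolant of p: it has degree below n and agrees with
      \<open>p mod P\<close> at n nodes, so the two coincide.\<close>
    define s where "s = (\<Sum>x\<in>X. Polynomial.smult (poly p x) (l x))"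
    have "p mod P - s = 0"
    proof (rule vanish)
      show "deg_lt n (p mod P - s)"
        using mod(1)[of p] dl by (simp add: deg_lt_def s_def coeff_sum)
      fix y assume y: "y \<in> X"
      have "poly s y = (\<Sum>x\<in>X. if x = y then poly p y else 0)"
        unfolding s_def poly_sum using l y by (intro sum.cong) auto
      then show "poly (p mod P - s) y = 0" using y fin mod(2)[of y p] by simp
    qed
    then have "P * (p div P) + s = p" using mult_div_mod_eq[of P p] by simp
    then have "mfun h p = mfun h (P * (p div P) + s)" by (simp only:)
    then show ?thesis using that by (simp add: s_def w_def mult.commute)
  qed
  ultimately show ?thesis using that fin card by blast
qed

section \<open>Moments of measures\<close>

definition poly_measure :: "real measure \<Rightarrow> bool" where
  "poly_measure \<mu> \<longleftrightarrow> sets \<mu> = sets borel \<and> finite_measure \<mu> \<and> (\<forall>p. integrable \<mu> (poly p))"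

abbreviation moment :: "real measure \<Rightarrow> nat \<Rightarrow> real" where
  "moment \<mu> i \<equiv> \<integral>x. x ^ i \<partial>\<mu>"

lemma integrable_power_of_poly:
  assumes "\<And>p. integrable \<mu> (poly p)"
  shows "integrable \<mu> (\<lambda>x::real. x ^ i)"
proof -
  have "poly (monom 1 i) = (\<lambda>x::real. x ^ i)" by (simp add: fun_eq_iff poly_monom)
  then show ?thesis using assms[of "monom 1 i"] by simp
qed

lemma mfun_moment:
  assumes "poly_measure \<mu>"
  shows "mfun (moment \<mu>) p = (\<integral>x. poly p x \<partial>\<mu>)"
proof -
  have int: "integrable \<mu> (\<lambda>x. x ^ i)" for i
    using assms by (intro integrable_power_of_poly) (auto simp: poly_measure_def)
  have "(\<integral>x. poly p x \<partial>\<mu>) = (\<integral>x. (\<Sum>i\<le>degree p. coeff p i * x ^ i) \<partial>\<mu>)"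
    by (simp add: poly_altdef)
  also have "\<dots> = (\<Sum>i\<le>degree p. coeff p i * moment \<mu> i)"
    using int by (subst Bochner_Integration.integral_sum) auto
  finally show ?thesis by (simp add: mfun_def)
qed

text \<open>The complement of the support is the union of all open null sets; by Lindelof countably
  many of them suffice, so it is a null set.\<close>

lemma AE_measure_support:
  assumes "sets \<mu> = sets borel"
  shows "AE x in \<mu>. x \<in> measure_support \<mu>"
proof -
  define F where "F = {U. open U \<and> emeasure \<mu> U = 0}"
  obtain F' where F': "F' \<subseteq> F" "countable F'" "\<Union>F' = \<Union>F"
    using Lindelof[of F] by (auto simp: F_def)
  have "(\<Union>U\<in>F'. U) \<in> null_sets \<mu>"
    using F'(1,2) assms by (intro null_sets_UN') (auto simp: F_def null_sets_def)
  then have "\<Union>F \<in> null_sets \<mu>" using F'(3) by simp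
  moreover have "{x \<in> space \<mu>. \<not> x \<in> measure_support \<mu>} \<subseteq> \<Union>F"
    unfolding measure_support_def F_def using not_gr_zero by blast
  ultimately show ?thesis by (rule AE_I')
qed

text \<open>If q^2 has integral 0, the open set where q is nonzero is a null set and so contains no
  point of the support.\<close>

lemma poly_zero_on_support:
  assumes "poly_measure \<mu>" "(\<integral>x. poly (q * q) x \<partial>\<mu>) = 0" "s \<in> measure_support \<mu>"
  shows "poly q s = 0"
proof (rule ccontr)
  assume s: "poly q s \<noteq> 0"
  have sets: "sets \<mu> = sets borel" and int: "integrable \<mu> (poly (q * q))"
    using assms(1) by (auto simp: poly_measure_def)
  have "AE x in \<mu>. poly (q * q) x = 0"
    using integral_nonneg_eq_0_iff_AE[OF int] assms(2) by simp
  then have AE: "AE x in \<mu>. \<not> x \<in> {x. poly q x \<noteq> 0}" by (auto elim: eventually_mono)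
  have op: "open {x. poly q x \<noteq> 0}"
    by (intro open_Collect_neq continuous_intros)
  then have "{x. poly q x \<noteq> 0} \<in> null_sets \<mu>"
    using AE sets by (subst AE_iff_null_sets) auto
  moreover have "emeasure \<mu> {x. poly q x \<noteq> 0} > 0"
    using assms(3) op s by (auto simp: measure_support_def)
  ultimately show False by (simp add: null_sets_def)
qed

text \<open>If the integral of q^2 vanished, every support point would be a root of q, too many for
  degree below n. Infinite support is a separate case because \<open>card\<close> is 0
  there.\<close>

lemma posdef_moment:
  assumes "poly_measure \<mu>" "infinite (measure_support \<mu>) \<or> n \<le> card (measure_support \<mu>)"
  shows "posdef (moment \<mu>) n"
  unfolding posdef_def
proof (intro allI impI)
  fix q :: "real poly" assume q: "q \<noteq> 0 \<and> deg_lt n q"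
  have "(\<integral>x. poly (q * q) x \<partial>\<mu>) \<noteq> 0"
  proof
    assume 0: "(\<integral>x. poly (q * q) x \<partial>\<mu>) = 0"
    have sub: "measure_support \<mu> \<subseteq> {x. poly q x = 0}"
      using poly_zero_on_support[OF assms(1) 0] by auto
    then have "finite (measure_support \<mu>)" "card (measure_support \<mu>) \<le> degree q"
      using q poly_roots_finite[of q] card_poly_roots_bound[of q]
      by (auto intro: finite_subset dest: card_mono[rotated])
    then show False using assms(2) q by (auto simp: deg_lt_iff)
  qed
  moreover have "(\<integral>x. poly (q * q) x \<partial>\<mu>) \<ge> 0" by (rule integral_nonneg_AE) simp
  ultimately show "mfun (moment \<mu>) (q * q) > 0" by (simp only: mfun_moment[OF assms(1)])
qed

text \<open>The product of the factors x - s over the support points s vanishes almost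
  everywhere.\<close>

lemma finite_support_annihilator:
  assumes "poly_measure \<mu>" "finite (measure_support \<mu>)"
  obtains q where "degree q = card (measure_support \<mu>)" "q \<noteq> 0" "\<And>r. mfun (moment \<mu>) (q * r) = 0"
proof -
  define q where "q = (\<Prod>s\<in>measure_support \<mu>. [:-s, 1:])"
  have "degree q = card (measure_support \<mu>)" unfolding q_def by (subst degree_prod_sum_eq) auto
  moreover have "q \<noteq> 0" using assms(2) by (simp add: q_def)
  moreover have "mfun (moment \<mu>) (q * r) = 0" for r
  proof -
    have "AE x in \<mu>. x \<in> measure_support \<mu>"
      using assms(1) by (intro AE_measure_support) (simp add: poly_measure_def)
    then have "AE x in \<mu>. poly (q * r) x = 0"
      by (rule eventually_mono) (use assms(2) in \<open>auto simp: q_def poly_prod\<close>)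
    then have "(\<integral>x. poly (q * r) x \<partial>\<mu>) = 0" by (rule integral_eq_zero_AE)
    then show ?thesis by (simp only: mfun_moment[OF assms(1)])
  qed
  ultimately show ?thesis by (rule that)
qed

text \<open>The annihilator has degree equal to the number of support points, so it is a kernel
  vector of every larger Hankel section.\<close>

lemma pos_def_order_moment:
  assumes "poly_measure \<mu>" "finite (measure_support \<mu>)"
  shows "pos_def_order (card (measure_support \<mu>)) (\<lambda>i j. moment \<mu> (i + j))"
proof -
  obtain q where q: "degree q = card (measure_support \<mu>)" "q \<noteq> 0" "\<And>r. mfun (moment \<mu>) (q * r) = 0"
    using finite_support_annihilator[OF assms] by metis
  have "posdef (moment \<mu>) (card (measure_support \<mu>))" using posdef_moment[OF assms(1)] by simp
  moreover have "hdet (moment \<mu>) n = 0" if "n > card (measure_support \<mu>)" for n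
    unfolding hdet_eq_0_iff[of "moment \<mu>" n] using q that by (intro exI[of _ q]) (auto simp: deg_lt_iff)
  ultimately show ?thesis by (simp add: pos_def_order_def posdef_iff_hdet)
qed

lemma infinite_support:
  assumes "poly_measure \<mu>" "\<And>n. posdef (moment \<mu>) n"
  shows "infinite (measure_support \<mu>)"
proof
  assume "finite (measure_support \<mu>)"
  then obtain q where q: "q \<noteq> 0" "\<And>r. mfun (moment \<mu>) (q * r) = 0"
    using finite_support_annihilator[OF assms(1)] by metis
  then show False
    using assms(2)[of "Suc (degree q)"] by (auto simp: posdef_def deg_lt_iff)
qed

text \<open>The sum of point masses \<open>w x\<close> at the points of X. The pushforward along the
  identity carries it from the power set of X to the Borel sets.\<close>

definition atomic_measure :: "real set \<Rightarrow> (real \<Rightarrow> real) \<Rightarrow> real measure" where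
  "atomic_measure X w = distr (point_measure X (\<lambda>x. ennreal (w x))) borel (\<lambda>x. x)"

lemma sets_atomic [simp]: "sets (atomic_measure X w) = sets borel"
  by (simp add: atomic_measure_def)

context
  fixes X :: "real set" and w :: "real \<Rightarrow> real"
  assumes fin: "finite X" and w: "\<And>x. x \<in> X \<Longrightarrow> w x \<ge> 0"
begin

lemma meas_id: "(\<lambda>x. x) \<in> measurable (point_measure X (\<lambda>x. ennreal (w x))) borel"
  by simp

lemma integral_atomic:
  assumes "f \<in> borel_measurable borel"
  shows "integrable (atomic_measure X w) f" "(\<integral>x. f x \<partial>atomic_measure X w) = (\<Sum>x\<in>X. w x * f x)"
proof -
  show "integrable (atomic_measure X w) f"
    unfolding atomic_measure_def using integrable_distr_eq[OF meas_id assms] integrable_point_measure_finite[OF fin]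
    by blast
  show "(\<integral>x. f x \<partial>atomic_measure X w) = (\<Sum>x\<in>X. w x * (f x :: real))"
    unfolding atomic_measure_def integral_distr[OF meas_id assms]
    using lebesgue_integral_point_measure_finite[of X w f, OF fin w] by simp
qed

lemma emeasure_atomic: 
  "emeasure (atomic_measure X w) UNIV = ennreal (\<Sum>x\<in>X. w x)"
  "emeasure (atomic_measure X w) (- X) = 0"
proof -
  have "emeasure (atomic_measure X w) UNIV = emeasure (point_measure X (\<lambda>x. ennreal (w x))) X"
    unfolding atomic_measure_def by (subst emeasure_distr[OF meas_id]) (auto simp: space_point_measure)
  also have "\<dots> = ennreal (\<Sum>x\<in>X. w x)"
    using w by (subst emeasure_point_measure_finite[OF fin]) (auto simp: sum_ennreal)
  finally show "emeasure (atomic_measure X w) UNIV = ennreal (\<Sum>x\<in>X. w x)" .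
  have "- X \<in> sets borel" using fin by (intro borel_open open_Compl finite_imp_closed)
  then show "emeasure (atomic_measure X w) (- X) = 0"
    unfolding atomic_measure_def by (subst emeasure_distr[OF meas_id]) (auto simp: space_point_measure)
qed

lemma poly_measure_atomic: "poly_measure (atomic_measure X w)"
proof -
  have "integrable (atomic_measure X w) (poly p)" for p
    by (rule integral_atomic) (intro borel_measurable_continuous_onI continuous_intros)
  moreover have "finite_measure (atomic_measure X w)"
    by (rule finite_measureI) (simp add: sets_eq_imp_space_eq[OF sets_atomic] emeasure_atomic)
  ultimately show ?thesis by (simp add: poly_measure_def)
qed

lemma finite_support_atomic: "finite (measure_support (atomic_measure X w))"
proof -
  have "open (- X)" using fin by (intro open_Compl finite_imp_closed)
  then have "measure_support (atomic_measure X w) \<subseteq> X"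
    using emeasure_atomic(2) by (auto simp: measure_support_def)
  then show ?thesis using fin by (rule finite_subset)
qed

end

text \<open>The orthogonal polynomial of degree m annihilates the functional, so its quadrature
  formula is exact in every degree and the atomic measure of nodes and weights has all the required
  moments.\<close>

lemma finite_order_moment_problem:
  assumes "pos_def_order m (\<lambda>i j. h (i + j))"
  obtains \<mu> where "poly_measure \<mu>" "finite (measure_support \<mu>)" "\<And>i. moment \<mu> i = h i"
proof -
  obtain P where P: "orth_poly h m P" "\<And>r. mfun h (P * r) = 0"
    using pos_def_order_annihilator[OF assms] by metis
  have "posdef h m" using assms by (simp add: pos_def_order_def posdef_iff_hdet)
  then obtain X w where X: "finite X" "\<And>x. x \<in> X \<Longrightarrow> w x > 0"
    "\<And>p. mfun h (P * (p div P)) = 0 \<Longrightarrow> mfun h p = (\<Sum>x\<in>X. w x * poly p x)"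
    using gauss_quadrature[OF _ P(1)] by metis
  have w: "\<And>x. x \<in> X \<Longrightarrow> w x \<ge> 0" using X(2) by force
  have "moment (atomic_measure X w) i = h i" for i
    using X(3)[of "monom 1 i"] P(2) integral_atomic(2)[of X w "\<lambda>x. x ^ i", OF X(1) w]
    by (simp add: poly_monom)
  then show ?thesis
    using that poly_measure_atomic[of X w, OF X(1) w] finite_support_atomic[of X w, OF X(1) w]
    by blast
qed

section \<open>The Hamburger moment problem\<close>

lemma poly_borel [measurable]: "poly (p :: real poly) \<in> borel_measurable borel"
  by (intro borel_measurable_continuous_onI continuous_intros)

lemma integrable_bounded_borel:
  assumes "real_distribution N" "f \<in> borel_measurable borel" "\<And>x. \<bar>f x\<bar> \<le> (B :: real)"
  shows "integrable N f"
proof -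
  interpret real_distribution N by fact
  have "f \<in> borel_measurable N" using assms(2) by (simp add: measurable_cong_sets[OF events_eq_borel refl])
  then show ?thesis using assms(3) by (intro integrable_const_bound[where B = B]) auto
qed

text \<open>Weak convergence only controls bounded test functions; \<open>g / (1 + \<epsilon> g\<^sup>2)\<close> is bounded and its distance
  to \<open>g\<close> is controlled by a higher moment.\<close>

lemma damped_bounds:
  fixes g e :: real
  assumes e: "0 < e" "e \<le> 1"
  shows "\<bar>g / (1 + e * g ^ 2)\<bar> \<le> 1 / e" "\<bar>g - g / (1 + e * g ^ 2)\<bar> \<le> e * (1 + g ^ 4)"
proof -
  have pos: "1 + e * g ^ 2 > 0" using e by (simp add: add_pos_nonneg)
  have "\<bar>g\<bar> \<le> 1 + g ^ 2"
    using zero_le_power2[of "\<bar>g\<bar> - 1 / 2"] by (simp add: power2_diff) (simp add: power2_eq_square)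
  then have "\<bar>g\<bar> * e \<le> (1 + g ^ 2) * e" using e by simp
  also have "\<dots> \<le> 1 + e * g ^ 2" using e by (simp add: algebra_simps)
  finally show "\<bar>g / (1 + e * g ^ 2)\<bar> \<le> 1 / e"
    using pos e by (simp add: abs_divide divide_simps mult.commute)
  have "\<bar>g\<bar> ^ 3 \<le> 1 + g ^ 4"
  proof (cases "\<bar>g\<bar> \<le> 1")
    case True
    then have "\<bar>g\<bar> ^ 3 \<le> 1" by (simp add: power_le_one)
    moreover have "0 \<le> g ^ 4" by simp
    ultimately show ?thesis by linarith
  next
    case False
    then have "\<bar>g\<bar> ^ 3 \<le> \<bar>g\<bar> ^ 4" by (intro power_increasing) auto
    then show ?thesis by simp
  qed
  moreover have "g - g / (1 + e * g ^ 2) = e * g ^ 3 / (1 + e * g ^ 2)"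
    using pos by (simp add: field_simps power2_eq_square power3_eq_cube)
  moreover have "\<bar>e * g ^ 3 / (1 + e * g ^ 2)\<bar> \<le> \<bar>e * g ^ 3\<bar>"
    using pos e by (simp add: abs_divide divide_le_eq mult_le_cancel_left1)
  moreover have "\<bar>e * g ^ 3\<bar> = e * \<bar>g\<bar> ^ 3" using e by (simp add: abs_mult power_abs)
  moreover have "e * \<bar>g\<bar> ^ 3 \<le> e * (1 + g ^ 4)" if "\<bar>g\<bar> ^ 3 \<le> 1 + g ^ 4"
    using that e by (intro mult_left_mono) auto
  ultimately show "\<bar>g - g / (1 + e * g ^ 2)\<bar> \<le> e * (1 + g ^ 4)" by simp
qed

text \<open>The error involves the measure only through the integral of p^4, so it is uniform along
  measures on which that integral is eventually constant.\<close>

lemma damped_integral: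
  assumes "real_distribution N" "integrable N (poly p)" "integrable N (poly (p ^ 4))" "0 < e" "e \<le> 1"
  shows "\<bar>(\<integral>x. poly p x \<partial>N) - (\<integral>x. poly p x / (1 + e * poly p x ^ 2) \<partial>N)\<bar>
    \<le> e * (1 + (\<integral>x. poly (p ^ 4) x \<partial>N))"
proof -
  interpret real_distribution N by fact
  have "poly (p ^ 4) = (\<lambda>x. poly p x ^ 4)" by (simp add: fun_eq_iff)
  then have int4: "integrable N (\<lambda>x. poly p x ^ 4)" using assms(3) by simp
  have int: "integrable N (\<lambda>x. poly p x / (1 + e * poly p x ^ 2))"
    using damped_bounds(1)[OF assms(4,5)] by (intro integrable_bounded_borel[OF assms(1)]) auto
  have "\<bar>(\<integral>x. poly p x \<partial>N) - (\<integral>x. poly p x / (1 + e * poly p x ^ 2) \<partial>N)\<bar> =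
      \<bar>\<integral>x. poly p x - poly p x / (1 + e * poly p x ^ 2) \<partial>N\<bar>"
    using assms(2) int by simp
  also have "\<dots> \<le> (\<integral>x. \<bar>poly p x - poly p x / (1 + e * poly p x ^ 2)\<bar> \<partial>N)"
    by (rule integral_abs_bound)
  also have "\<dots> \<le> (\<integral>x. e * (1 + poly (p ^ 4) x) \<partial>N)"
    using assms(2) int4 int damped_bounds(2)[OF assms(4,5)]
    by (intro integral_mono integrable_abs integrable_mult_right Bochner_Integration.integrable_add
      Bochner_Integration.integrable_diff) simp_all
  also have "\<dots> = e * (\<integral>x. 1 + poly (p ^ 4) x \<partial>N)"
    by (rule integral_mult_right_zero)
  also have "(\<integral>x. 1 + poly (p ^ 4) x \<partial>N) = 1 + (\<integral>x. poly (p ^ 4) x \<partial>N)"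
    using int4 assms(3) prob_space by (subst Bochner_Integration.integral_add) simp_all
  finally show ?thesis .
qed

text \<open>The functions g / (1 + g / (k+1)) are bounded and continuous and increase to g. Weak
  convergence bounds their integrals in the limit by \<open>c g\<close>, and monotone convergence
  gives integrability.\<close>

lemma integrable_of_weak_limit:
  assumes "\<And>n. real_distribution (\<kappa> n)" "real_distribution M" "weak_conv_m \<kappa> M"
    and int: "\<And>n p. integrable (\<kappa> n) (poly p)"
    and c: "\<And>p. eventually (\<lambda>n. (\<integral>x. poly p x \<partial>\<kappa> n) = c p) sequentially"
    and nonneg: "\<And>x. poly g x \<ge> 0"
  shows "integrable M (poly g)"
proof -
  interpret M: real_distribution M by fact
  define f where "f k x = poly g x / (1 + poly g x / real (Suc k))" for k x
  have den: "1 + poly g x / real (Suc k) > 0" for k x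
    using nonneg[of x] by (simp add: add_pos_nonneg)
  have f0: "f k x \<ge> 0" for k x using den[of x k] nonneg[of x] by (simp add: f_def)
  have fB: "f k x \<le> real (Suc k)" for k x
    using den[of x k] nonneg[of x] by (simp add: f_def divide_le_eq field_simps del: of_nat_Suc)
  have fg: "f k x \<le> poly g x" for k x
    using den[of x k] nonneg[of x] by (simp add: f_def divide_le_eq mult_le_cancel_left1 del: of_nat_Suc)
  have fmono: "f k x \<le> f l x" if "k \<le> l" for k l x
    unfolding f_def using den[of x k] den[of x l] nonneg[of x] that
    by (intro divide_left_mono add_left_mono) (auto intro: divide_left_mono)
  have flim: "(\<lambda>k. f k x) \<longlonglongrightarrow> poly g x" for x
  proof -
    have "(\<lambda>k. poly g x / real (Suc k)) \<longlonglongrightarrow> 0"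
      using tendsto_mult_right_zero[OF lim_inverse_n'[THEN LIMSEQ_Suc]] by (simp add: divide_inverse)
    then have "(\<lambda>k. poly g x / (1 + poly g x / real (Suc k))) \<longlonglongrightarrow> poly g x / (1 + 0)"
      by (intro tendsto_intros) auto
    then show ?thesis by (simp add: f_def)
  qed
  have fc: "isCont (f k) x" for k x
    unfolding f_def using den[of x k] by (intro continuous_intros) auto
  then have fm: "f k \<in> borel_measurable borel" for k
    by (intro borel_measurable_continuous_onI) (simp add: continuous_at_imp_continuous_on)
  have fi: "integrable N (f k)" if "real_distribution N" for N k
    using fB f0 by (intro integrable_bounded_borel[OF that fm]) (simp add: abs_of_nonneg)
  have le: "(\<integral>x. f k x \<partial>M) \<le> c g" for k
  proof (rule LIMSEQ_le_const2)
    show "(\<lambda>n. \<integral>x. f k x \<partial>\<kappa> n) \<longlonglongrightarrow> (\<integral>x. f k x \<partial>M)"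
      using fB f0 by (intro weak_conv_imp_integral_bdd_continuous_conv[where B = "real (Suc k)"] assms fc)
        (simp add: abs_of_nonneg)
    have "eventually (\<lambda>n. (\<integral>x. f k x \<partial>\<kappa> n) \<le> c g) sequentially"
      using c[of g]
    proof (rule eventually_mono)
      fix n assume "(\<integral>x. poly g x \<partial>\<kappa> n) = c g"
      moreover have "(\<integral>x. f k x \<partial>\<kappa> n) \<le> (\<integral>x. poly g x \<partial>\<kappa> n)"
        by (intro integral_mono fi assms int fg)
      ultimately show "(\<integral>x. f k x \<partial>\<kappa> n) \<le> c g" by simp
    qed
    then show "\<exists>N. \<forall>n\<ge>N. (\<integral>x. f k x \<partial>\<kappa> n) \<le> c g" by (simp add: eventually_sequentially)
  qed
  have inc: "incseq (\<lambda>k. \<integral>x. f k x \<partial>M)"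
    by (rule incseq_SucI) (intro integral_mono fi assms fmono, simp)
  obtain L where L: "(\<lambda>k. \<integral>x. f k x \<partial>M) \<longlonglongrightarrow> L"
    using incseq_convergent[OF inc] le by blast
  have gm: "poly g \<in> borel_measurable M"
    by (simp add: measurable_cong_sets[OF M.events_eq_borel refl])
  show ?thesis
    by (rule integrable_monotone_convergence[where f = f, OF fi[OF assms(2)] _ _ L gm])
      (auto simp: mono_def fmono flim)
qed

text \<open>Integrability of p follows from that of p^4, which is nonnegative. The damped integrals
  converge for each fixed e and differ from those of p by O(e), both in the limit and eventually
  along the sequence.\<close>

lemma integral_of_weak_limit:
  assumes "\<And>n. real_distribution (\<kappa> n)" "real_distribution M" "weak_conv_m \<kappa> M"
    and int: "\<And>n p. integrable (\<kappa> n) (poly p)"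
    and c: "\<And>p. eventually (\<lambda>n. (\<integral>x. poly p x \<partial>\<kappa> n) = c p) sequentially"
  shows "integrable M (poly p)" "(\<integral>x. poly p x \<partial>M) = c p"
proof -
  interpret M: real_distribution M by fact
  have i4: "integrable M (poly (p ^ 4))"
    by (rule integrable_of_weak_limit[OF assms]) simp
  have pm: "poly p \<in> borel_measurable M"
    by (simp add: measurable_cong_sets[OF M.events_eq_borel refl])
  have "\<bar>y\<bar> \<le> 1 + y ^ 4" for y :: real
  proof (cases "\<bar>y\<bar> \<le> 1")
    case True
    moreover have "0 \<le> y ^ 4" by simp
    ultimately show ?thesis by linarith
  next
    case False
    then have "\<bar>y\<bar> ^ 1 \<le> \<bar>y\<bar> ^ 4" by (intro power_increasing) auto
    then show ?thesis by simp
  qed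
  then have "norm (poly p x) \<le> norm (1 + poly (p ^ 4) x)" for x
    using zero_le_even_power[of 4 "poly p x"] by simp
  then show i1: "integrable M (poly p)"
    by (intro Bochner_Integration.integrable_bound[of M "\<lambda>x. 1 + poly (p ^ 4) x", OF _ pm]
      Bochner_Integration.integrable_add i4 M.integrable_const AE_I2)
  \<comment> \<open>The sum of the two damping errors, one for the limit and one for the sequence,
    divided by e.\<close>
  define C where "C = 2 + (\<integral>x. poly (p ^ 4) x \<partial>M) + c (p ^ 4)"
  have est: "\<bar>(\<integral>x. poly p x \<partial>M) - c p\<bar> \<le> e * C" if e: "0 < e" "e \<le> 1" for e
  proof -
    define f where "f x = poly p x / (1 + e * poly p x ^ 2)" for x
    have "1 + e * poly p x ^ 2 > 0" for x using e by (simp add: add_pos_nonneg)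
    then have "isCont (\<lambda>x. poly p x / (1 + e * poly p x ^ 2)) x" for x
      by (intro continuous_intros) (metis less_irrefl)
    then have fc: "isCont f x" for x unfolding f_def[abs_def] .
    have fB: "norm (f x) \<le> 1 / e" for x using damped_bounds(1)[OF e] by (simp add: f_def)
    have "(\<lambda>n. \<integral>x. f x \<partial>\<kappa> n) \<longlonglongrightarrow> (\<integral>x. f x \<partial>M)"
      by (rule weak_conv_imp_integral_bdd_continuous_conv[OF assms(1-3) fc fB])
    then have "(\<lambda>n. \<bar>c p - (\<integral>x. f x \<partial>\<kappa> n)\<bar>) \<longlonglongrightarrow> \<bar>c p - (\<integral>x. f x \<partial>M)\<bar>"
      by (intro tendsto_intros)
    moreover have "eventually (\<lambda>n. \<bar>c p - (\<integral>x. f x \<partial>\<kappa> n)\<bar> \<le> e * (1 + c (p ^ 4))) sequentially"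
      using c[of p] c[of "p ^ 4"]
    proof eventually_elim
      case (elim n)
      show ?case using damped_integral[of "\<kappa> n" p e, OF assms(1) int int e] unfolding elim f_def .
    qed
    ultimately have "\<bar>c p - (\<integral>x. f x \<partial>M)\<bar> \<le> e * (1 + c (p ^ 4))"
      by (intro tendsto_upperbound) auto
    moreover have "\<bar>(\<integral>x. poly p x \<partial>M) - (\<integral>x. f x \<partial>M)\<bar> \<le> e * (1 + (\<integral>x. poly (p ^ 4) x \<partial>M))"
      using damped_integral[OF assms(2) i1 i4 e] by (simp add: f_def)
    ultimately show ?thesis by (simp add: C_def algebra_simps)
  qed
  show "(\<integral>x. poly p x \<partial>M) = c p"
  proof (rule ccontr)
    assume "(\<integral>x. poly p x \<partial>M) \<noteq> c p"
    then have pos: "\<bar>(\<integral>x. poly p x \<partial>M) - c p\<bar> > 0" (is "?d > 0") by simp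
    then have C: "C > 0" using est[of 1] by simp
    \<comment> \<open>Small enough for the error to be at most half the supposed gap, and at most 1
      as the damping estimate demands.\<close>
    define e where "e = min 1 (?d / (2 * C))"
    have "e * C \<le> ?d / (2 * C) * C" unfolding e_def using C by (intro mult_right_mono) auto
    then have "e * C \<le> ?d / 2" using C by simp
    moreover have "?d \<le> e * C" using pos C by (intro est) (auto simp: e_def)
    ultimately show False using pos by simp
  qed
qed

lemma tight_of_second_moment:
  assumes rd: "\<And>n. real_distribution (\<nu> n)"
    and int: "\<And>n. integrable (\<nu> n) (\<lambda>x. x ^ 2)" "\<And>n. (\<integral>x. x ^ 2 \<partial>\<nu> n) \<le> B"
  shows "tight \<nu>"
  unfolding tight_def
proof (intro conjI allI impI rd)
  fix e :: real assume e: "e > 0"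
  \<comment> \<open>Markov's inequality bounds the mass outside by B / R^2, which this R makes
    smaller than e. The term \<bar>B\<bar> + 1 keeps R positive and the inequality strict.\<close>
  define R where "R = sqrt ((\<bar>B\<bar> + 1) / e)"
  have R: "R > 0" "R ^ 2 = (\<bar>B\<bar> + 1) / e" using e by (auto simp: R_def add_nonneg_pos)
  have "1 - e < measure (\<nu> n) {-R<..R}" for n
  proof -
    interpret real_distribution "\<nu> n" by (rule rd)
    have "1 - measure (\<nu> n) {-R<..R} = measure (\<nu> n) (space (\<nu> n) - {-R<..R})"
      by (subst prob_compl) auto
    also have "\<dots> \<le> measure (\<nu> n) {x \<in> space (\<nu> n). R ^ 2 \<le> x ^ 2}"
    proof (rule finite_measure_mono)
      show "space (\<nu> n) - {-R<..R} \<subseteq> {x \<in> space (\<nu> n). R ^ 2 \<le> x ^ 2}"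
        using R(1) by (auto simp: abs_le_square_iff[symmetric])
    qed simp
    also have "\<dots> \<le> (\<integral>x. x ^ 2 \<partial>\<nu> n) / R ^ 2"
      using R(1) by (intro integral_Markov_inequality_measure[where A = "{}"] int) auto
    also have "\<dots> \<le> B / R ^ 2" using int(2)[of n] R(1) by (intro divide_right_mono) auto
    also have "\<dots> < e"
    proof -
      have "B * e < (\<bar>B\<bar> + 1) * e" using e by (intro mult_strict_right_mono) auto
      moreover have "\<bar>B\<bar> + 1 > 0" by simp
      ultimately show ?thesis unfolding R(2) by (simp add: pos_divide_less_eq mult.commute)
    qed
    finally show ?thesis by simp
  qed
  then show "\<exists>a b. a < b \<and> (\<forall>n. 1 - e < measure (\<nu> n) {a<..b})"
    using R(1) by (intro exI[of _ "-R"] exI[of _ R]) auto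
qed

lemma hamburger_moment_problem:
  assumes "\<And>n. posdef h n"
  obtains \<mu> where "poly_measure \<mu>" "infinite (measure_support \<mu>)" "\<And>i. moment \<mu> i = h i"
proof -
  have h0: "h 0 > 0" using posdef_0_pos[OF assms[of 1]] by simp
  have "\<exists>X w. finite X \<and> (\<forall>x\<in>X. w x > 0) \<and> (\<forall>p. deg_lt (n + n) p \<longrightarrow> mfun h p = (\<Sum>x\<in>X. w x * poly p x))"
    for n
  proof -
    obtain P where P: "orth_poly h n P" using assms by (rule orth_poly_exists)
    obtain X w where X: "finite X" "\<And>x. x \<in> X \<Longrightarrow> w x > 0"
      "\<And>p. mfun h (P * (p div P)) = 0 \<Longrightarrow> mfun h p = (\<Sum>x\<in>X. w x * poly p x)"
      using gauss_quadrature[OF assms P] by metis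
    moreover have "mfun h (P * (p div P)) = 0" if "deg_lt (n + n) p" for p
      using P deg_lt_div[OF _ _ that] degree_orth_poly[OF P] by (auto simp: orth_poly_def)
    ultimately show ?thesis by blast
  qed
  then obtain X w where X: "\<And>n. finite (X n)" "\<And>n x. x \<in> X n \<Longrightarrow> w n x > 0"
    "\<And>n p. deg_lt (n + n) p \<Longrightarrow> mfun h p = (\<Sum>x\<in>X n. w n x * poly p x)"
    by metis
  \<comment> \<open>Division by \<open>h 0\<close> gives probability measures. With n + 2 nodes the
    quadrature is exact below degree 2n + 4, so second moments are correct from n = 0 on.\<close>
  define \<nu> where "\<nu> n = atomic_measure (X (n + 2)) (\<lambda>x. w (n + 2) x / h 0)" for n
  have w0: "w (n + 2) x / h 0 \<ge> 0" if "x \<in> X (n + 2)" for n x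
    using X(2)[OF that] h0 by simp
  have int: "integrable (\<nu> n) (poly p)" for n p
    unfolding \<nu>_def by (rule integral_atomic(1)[OF X(1) w0 poly_borel])
  have int_eq: "(\<integral>x. poly p x \<partial>\<nu> n) = (\<Sum>x\<in>X (n + 2). w (n + 2) x / h 0 * poly p x)" for n p
    unfolding \<nu>_def by (rule integral_atomic(2)[OF X(1) w0 poly_borel])
  have mom: "(\<integral>x. poly p x \<partial>\<nu> n) = mfun h p / h 0" if "degree p < 2 * n + 4" for n p
    using that X(3)[of "n + 2" p] unfolding int_eq
    by (simp add: deg_lt_iff sum_divide_distrib)
  have rd: "real_distribution (\<nu> n)" for n
  proof -
    have "(\<Sum>x\<in>X (n + 2). w (n + 2) x / h 0) = 1"
    proof -
      have "(\<Sum>x\<in>X (n + 2). w (n + 2) x) = h 0"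
        using X(3)[of "n + 2" 1] by (simp add: deg_lt_iff mfun_1)
      then show ?thesis unfolding sum_divide_distrib[symmetric] using h0 by simp
    qed
    moreover have "emeasure (\<nu> n) UNIV = ennreal (\<Sum>x\<in>X (n + 2). w (n + 2) x / h 0)"
      unfolding \<nu>_def by (rule emeasure_atomic(1)[OF X(1) w0])
    ultimately have "emeasure (\<nu> n) UNIV = 1" by simp
    moreover have "space (\<nu> n) = UNIV"
      using sets_eq_imp_space_eq[OF sets_atomic] by (simp add: \<nu>_def)
    ultimately have "prob_space (\<nu> n)" by (intro prob_spaceI) simp
    then show ?thesis
      by (simp add: real_distribution_def real_distribution_axioms_def \<nu>_def)
  qed
  have "tight \<nu>"
  proof (rule tight_of_second_moment[OF rd])
    have p2: "poly (monom 1 2) = (\<lambda>x::real. x ^ 2)" by (simp add: fun_eq_iff poly_monom)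
    show "integrable (\<nu> n) (\<lambda>x. x ^ 2)" for n using int[of n "monom 1 2"] by (simp add: p2)
    show "(\<integral>x. x ^ 2 \<partial>\<nu> n) \<le> h 2 / h 0" for n
      using mom[of "monom 1 2" n] by (simp add: p2 degree_monom_eq)
  qed
  then obtain r M where r: "strict_mono r" and M: "real_distribution M" "weak_conv_m (\<nu> \<circ> id \<circ> r) M"
    using tight_imp_convergent_subsubsequence[OF _ strict_mono_id] by blast
  \<comment> \<open>Each polynomial is integrated exactly from some index on, since r n \<ge>
    n.\<close>
  have "eventually (\<lambda>n. (\<integral>x. poly p x \<partial>(\<nu> \<circ> id \<circ> r) n) = mfun h p / h 0) sequentially" for p
    unfolding eventually_sequentially
  proof (intro exI allI impI)
    fix n assume "n \<ge> degree p"
    then show "(\<integral>x. poly p x \<partial>(\<nu> \<circ> id \<circ> r) n) = mfun h p / h 0"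
      using strict_mono_imp_increasing[OF r, of n] by (simp add: mom)
  qed
  then have lim: "integrable M (poly p)" "(\<integral>x. poly p x \<partial>M) = mfun h p / h 0" for p
    using integral_of_weak_limit[of "\<nu> \<circ> id \<circ> r" M "\<lambda>p. mfun h p / h 0" p] rd M int by auto
  interpret M: real_distribution M by (rule M(1))
  \<comment> \<open>Undoes the normalisation to total mass 1.\<close>
  define \<mu> where "\<mu> = density M (\<lambda>x. ennreal (h 0))"
  have pm: "poly p \<in> borel_measurable M" for p
    by (simp add: measurable_cong_sets[OF M.events_eq_borel refl])
  have "integrable \<mu> (poly p)" for p
    unfolding \<mu>_def using h0 lim(1) pm by (subst integrable_density) auto
  moreover have "finite_measure \<mu>"
    by (rule finite_measureI)
      (simp add: \<mu>_def emeasure_density_const M.emeasure_space_1 ennreal_mult_eq_top_iff)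
  ultimately have \<mu>: "poly_measure \<mu>" by (simp add: poly_measure_def \<mu>_def)
  have "(\<integral>x. poly p x \<partial>\<mu>) = mfun h p" for p
    unfolding \<mu>_def using h0 pm lim(2) by (subst integral_density) auto
  from this[of "monom 1 i" for i] have mom: "moment \<mu> i = h i" for i by (simp add: poly_monom)
  have "moment \<mu> = h" using mom by (simp add: fun_eq_iff)
  then have "infinite (measure_support \<mu>)" using infinite_support[OF \<mu>] assms by simp
  then show ?thesis using that \<mu> mom by blast
qed

section \<open>Sobolev moments\<close>

lemma higher_pderiv_monom_falling: "(pderiv ^^ k) (monom 1 i) = monom (falling i k) (i - k)"
proof (induction k)
  case (Suc k)
  show ?case
  proof (cases "k \<le> i")
    case True
    then show ?thesis by (simp add: Suc.IH pderiv_monom falling_Suc of_nat_diff mult.commute)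
  qed (simp add: Suc.IH pderiv_monom falling_eq_0)
qed (simp add: falling_def)

lemma higher_pderiv_eq_sum:
  "(pderiv ^^ k) p = (\<Sum>i\<le>degree p. Polynomial.smult (coeff p i) ((pderiv ^^ k) (monom 1 i)))"
proof -
  have "p = (\<Sum>i\<le>degree p. Polynomial.smult (coeff p i) (monom 1 i))"
    using poly_as_sum_of_monoms[of p] by (simp add: smult_monom)
  then have "(pderiv ^^ k) p = (pderiv ^^ k) (\<Sum>i\<le>degree p. Polynomial.smult (coeff p i) (monom 1 i))"
    by (rule arg_cong)
  then show ?thesis by (simp only: higher_pderiv_sum higher_pderiv_smult)
qed

definition hankel_moments :: "(nat \<Rightarrow> real measure) \<Rightarrow> nat \<Rightarrow> infmat" where
  "hankel_moments \<mu> k = (\<lambda>i j. moment (\<mu> k) (i + j))"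

lemma hankel_hankel_moments: "hankel (hankel_moments \<mu> k)"
  by (simp add: hankel_def hankel_moments_def)

text \<open>By bilinearity it suffices to treat monomials: the k-th derivatives of x^i and x^j
  multiply to two falling factorials times x^(i+j-2k), whose integral is the entry of the k-th
  Sobolev term.\<close>

lemma sobolev_form_eq:
  assumes "\<And>k. k \<le> d \<Longrightarrow> poly_measure (\<mu> k)"
  shows "sobolev_form d \<mu> p q = (\<Sum>i\<le>degree p. \<Sum>j\<le>degree q. coeff p i *
    (\<Sum>k\<le>d. sobolev_term k (hankel_moments \<mu> k) i j) * coeff q j)"
proof -
  have int: "(\<integral>x. poly ((pderiv ^^ k) p) x * poly ((pderiv ^^ k) q) x \<partial>(\<mu> k)) =
      (\<Sum>i\<le>degree p. \<Sum>j\<le>degree q. coeff p i * sobolev_term k (hankel_moments \<mu> k) i j * coeff q j)"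
    if "k \<le> d" for k
  proof -
    have "(pderiv ^^ k) p * (pderiv ^^ k) q = (\<Sum>i\<le>degree p. \<Sum>j\<le>degree q.
        Polynomial.smult (coeff p i * coeff q j) ((pderiv ^^ k) (monom 1 i) * (pderiv ^^ k) (monom 1 j)))"
      by (subst (1 2) higher_pderiv_eq_sum) (simp add: sum_product mult.commute)
    also have "\<dots> = (\<Sum>i\<le>degree p. \<Sum>j\<le>degree q.
        monom (coeff p i * coeff q j * (falling i k * falling j k)) (i - k + (j - k)))"
      by (simp add: higher_pderiv_monom_falling mult_monom smult_monom)
    finally have prod: "(pderiv ^^ k) p * (pderiv ^^ k) q = \<dots>" .
    have "(\<integral>x. poly ((pderiv ^^ k) p) x * poly ((pderiv ^^ k) q) x \<partial>(\<mu> k)) =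
        mfun (moment (\<mu> k)) ((pderiv ^^ k) p * (pderiv ^^ k) q)"
      by (simp add: mfun_moment[OF assms[OF that]])
    also have "\<dots> = (\<Sum>i\<le>degree p. \<Sum>j\<le>degree q.
        coeff p i * coeff q j * (falling i k * falling j k) * moment (\<mu> k) (i - k + (j - k)))"
      unfolding prod by simp
    also have "\<dots> = (\<Sum>i\<le>degree p. \<Sum>j\<le>degree q.
        coeff p i * sobolev_term k (hankel_moments \<mu> k) i j * coeff q j)"
      by (intro sum.cong refl) (auto simp: sobolev_term_entry hankel_moments_def falling_eq_0 not_le)
    finally show ?thesis .
  qed
  have "sobolev_form d \<mu> p q = (\<Sum>k\<le>d. \<Sum>i\<le>degree p. \<Sum>j\<le>degree q.
      coeff p i * sobolev_term k (hankel_moments \<mu> k) i j * coeff q j)"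
    unfolding sobolev_form_def by (intro sum.cong refl int) simp
  also have "\<dots> = (\<Sum>i\<le>degree p. \<Sum>k\<le>d. \<Sum>j\<le>degree q.
      coeff p i * sobolev_term k (hankel_moments \<mu> k) i j * coeff q j)"
    by (rule sum.swap)
  also have "\<dots> = (\<Sum>i\<le>degree p. \<Sum>j\<le>degree q. \<Sum>k\<le>d.
      coeff p i * sobolev_term k (hankel_moments \<mu> k) i j * coeff q j)"
    by (intro sum.cong refl sum.swap)
  finally show ?thesis by (simp only: sum_distrib_left sum_distrib_right)
qed

section \<open>Bilinear forms and their matrices\<close>

definition bilinear_form :: "infmat \<Rightarrow> real poly \<Rightarrow> real poly \<Rightarrow> real" where
  "bilinear_form M p q = (\<Sum>i\<le>degree p. \<Sum>j\<le>degree q. coeff p i * M i j * coeff q j)"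

lemma bilinear_form_monom: "bilinear_form M (monom 1 i) (monom 1 j) = M i j"
proof -
  have "bilinear_form M (monom 1 i) (monom 1 j) =
      (\<Sum>a\<le>i. \<Sum>b\<le>j. if b = j then (if a = i then M i j else 0) else 0)"
    unfolding bilinear_form_def by (intro sum.cong) (auto simp: degree_monom_eq)
  then show ?thesis by simp
qed

text \<open>Pairs of monomials read off the individual entries.\<close>

lemma bilinear_form_eq_iff: "bilinear_form M = bilinear_form N \<longleftrightarrow> M = N"
  by (metis bilinear_form_monom ext)

lemma sobolev_form_eq_bilinear_form_iff:
  assumes "\<And>k. k \<le> d \<Longrightarrow> poly_measure (\<mu> k)"
  shows "(\<forall>p q. sobolev_form d \<mu> p q = bilinear_form M p q) \<longleftrightarrow>
    (\<forall>i j. M i j = (\<Sum>k\<le>d. sobolev_term k (hankel_moments \<mu> k) i j))"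
proof -
  define N where "N = (\<lambda>i j. \<Sum>k\<le>d. sobolev_term k (hankel_moments \<mu> k) i j)"
  have "sobolev_form d \<mu> = bilinear_form N"
    by (intro ext) (simp add: sobolev_form_eq[OF assms] bilinear_form_def N_def)
  then have "(\<forall>p q. sobolev_form d \<mu> p q = bilinear_form M p q) \<longleftrightarrow> M = N"
    using bilinear_form_eq_iff[of M N] by (metis ext)
  then show ?thesis by (simp add: N_def fun_eq_iff)
qed

section \<open>Passage between measures and Hankel decompositions\<close>

lemma Sum_any_sobolev_term:
  assumes "\<And>k. k > d \<Longrightarrow> H k = inf_zero"
  shows "Sum_any (\<lambda>k. sobolev_term k (H k) i j) = (\<Sum>k\<le>d. sobolev_term k (H k) i j)"
proof (rule Sum_any.expand_superset)
  show "{k. sobolev_term k (H k) i j \<noteq> 0} \<subseteq> {..d}"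
    using assms by (auto simp: not_le[symmetric]) (metis not_le sobolev_term_zero)
qed simp

lemma emeasure_UNIV_pos:
  assumes "measure_support \<mu> \<noteq> {}"
  shows "emeasure \<mu> UNIV > 0"
  using assms open_UNIV unfolding measure_support_def by blast

text \<open>Entry (0, 0) is the total mass, which is positive.\<close>

lemma hankel_moments_nonzero:
  assumes "poly_measure (\<mu> k)" "measure_support (\<mu> k) \<noteq> {}"
  shows "hankel_moments \<mu> k \<noteq> inf_zero"
proof
  assume "hankel_moments \<mu> k = inf_zero"
  then have "hankel_moments \<mu> k 0 0 = 0" by (simp add: inf_zero_def)
  then have "moment (\<mu> k) 0 = 0" by (simp add: hankel_moments_def)
  moreover have *: "infinite (measure_support (\<mu> k)) \<or> 1 \<le> card (measure_support (\<mu> k))"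
    using assms(2) by (auto simp: Suc_le_eq card_gt_0_iff)
  have "moment (\<mu> k) 0 > 0"
    by (rule posdef_0_pos[OF posdef_moment[OF assms(1) *]]) simp
  ultimately show False by linarith
qed

lemma hankel_moments_eq_zero:
  assumes "poly_measure (\<mu> k)" "measure_support (\<mu> k) = {}"
  shows "hankel_moments \<mu> k = inf_zero"
proof -
  have "AE x in \<mu> k. False"
    using AE_measure_support[of "\<mu> k"] assms by (simp add: poly_measure_def)
  then have "moment (\<mu> k) i = 0" for i
    by (intro integral_eq_zero_AE) (auto elim: eventually_mono)
  then show ?thesis by (simp add: hankel_moments_def inf_zero_def)
qed

lemma sobolev_measures_iff:
  "sobolev_measures d \<mu> \<longleftrightarrow> (\<forall>k\<le>d. poly_measure (\<mu> k)) \<and> infinite (measure_support (\<mu> 0))"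
proof -
  have "measure_support (\<mu> 0) \<noteq> {}" if "infinite (measure_support (\<mu> 0))" using that by auto
  then show ?thesis
    unfolding sobolev_measures_def poly_measure_def using emeasure_UNIV_pos[of "\<mu> 0"]
    by blast
qed

text \<open>The index e can be smaller than d, because the last measures may vanish; e is the last
  position with nonempty support.\<close>

lemma sobolev_moments_necessary:
  assumes pm: "\<And>k. k \<le> d \<Longrightarrow> poly_measure (\<mu> k)" and inf: "infinite (measure_support (\<mu> 0))"
    and fin: "\<And>k. k \<in> {1..d} \<Longrightarrow> finite (measure_support (\<mu> k))"
    and M: "\<And>i j. M i j = (\<Sum>k\<le>d. sobolev_term k (hankel_moments \<mu> k) i j)"
  shows "\<exists>e. hankel_sobolev M e \<and> pos_def_inf (extracted M e e) \<and>
    (\<forall>k<e. \<exists>m. pos_def_order m (extracted M e k))"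
proof -
  define e where "e = (GREATEST k. k \<le> d \<and> measure_support (\<mu> k) \<noteq> {})"
  have ex: "0 \<le> d \<and> measure_support (\<mu> 0) \<noteq> {}" using inf by auto
  have e: "e \<le> d" "measure_support (\<mu> e) \<noteq> {}"
    using GreatestI_nat[where P = "\<lambda>k. k \<le> d \<and> measure_support (\<mu> k) \<noteq> {}", OF ex, of d]
    by (auto simp: e_def)
  have max: "measure_support (\<mu> k) = {}" if "e < k" "k \<le> d" for k
    using Greatest_le_nat[where P = "\<lambda>k. k \<le> d \<and> measure_support (\<mu> k) \<noteq> {}", of k d] that
    by (force simp: e_def)
  \<comment> \<open>Cut off above e, since index e requires \<open>inf_zero\<close> at all later
    positions, including those beyond d.\<close>
  define H where "H k = (if k \<le> e then hankel_moments \<mu> k else inf_zero)" for k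
  have H: "hankel (H k)" for k
    using hankel_hankel_moments[of \<mu> k] by (auto simp: H_def hankel_def inf_zero_def)
  have ME: "M i j = (\<Sum>k\<le>e. sobolev_term k (H k) i j)" for i j
  proof -
    have "M i j = (\<Sum>k\<le>e. sobolev_term k (hankel_moments \<mu> k) i j)"
      unfolding M
    proof (rule sum.mono_neutral_right)
      show "\<forall>k\<in>{..d} - {..e}. sobolev_term k (hankel_moments \<mu> k) i j = 0"
      proof
        fix k assume "k \<in> {..d} - {..e}"
        then have "hankel_moments \<mu> k = inf_zero"
          by (intro hankel_moments_eq_zero pm max) auto
        then show "sobolev_term k (hankel_moments \<mu> k) i j = 0" by simp
      qed
    qed (use e(1) in auto)
    then show ?thesis by (simp add: H_def)
  qed
  have "hankel_sobolev M e"
    unfolding hankel_sobolev_def hankel_sobolev_decomp_def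
  proof (intro exI[of _ H] conjI allI impI H ext)
    show "M i j = Sum_any (\<lambda>k. sobolev_term k (H k) i j)" for i j
      using Sum_any_sobolev_term[of e H i j] ME by (simp add: H_def)
    show "H e \<noteq> inf_zero"
      using hankel_moments_nonzero[of \<mu> e, OF pm[OF e(1)] e(2)] by (simp add: H_def)
  qed (simp add: H_def)
  moreover have ext: "extracted M e k = hankel_moments \<mu> (e - k)" if "k \<le> e" for k
    using residual_hankel_sobolev(2)[OF H ME that] by (simp add: H_def)
  moreover have "pos_def_inf (hankel_moments \<mu> 0)"
    unfolding hankel_moments_def pos_def_inf_iff[of "moment (\<mu> 0)"]
    using inf by (intro allI posdef_moment pm) auto
  moreover have "\<exists>m. pos_def_order m (extracted M e k)" if "k < e" for k
  proof -
    have "pos_def_order (card (measure_support (\<mu> (e - k)))) (hankel_moments \<mu> (e - k))"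
      unfolding hankel_moments_def using that e(1) by (intro pos_def_order_moment pm fin) auto
    then show ?thesis using ext[of k] that by auto
  qed
  ultimately show ?thesis by (intro exI[of _ e]) auto
qed

lemma sobolev_moments_sufficient:
  assumes "hankel_sobolev M d" "pos_def_inf (extracted M d d)"
    and fin: "\<And>k. k < d \<Longrightarrow> \<exists>m. pos_def_order m (extracted M d k)"
  obtains \<mu> where "\<And>k. poly_measure (\<mu> k)" "infinite (measure_support (\<mu> 0))"
    "\<And>k. k \<in> {1..d} \<Longrightarrow> finite (measure_support (\<mu> k))"
    "\<And>i j. M i j = (\<Sum>k\<le>d. sobolev_term k (hankel_moments \<mu> k) i j)"
proof -
  obtain H where "\<And>k. hankel (H k)" "M = (\<lambda>i j. Sum_any (\<lambda>k. sobolev_term k (H k) i j))"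
    and z: "\<And>k. k > d \<Longrightarrow> H k = inf_zero"
    using assms(1) by (auto simp: hankel_sobolev_def hankel_sobolev_decomp_def)
  then have H: "\<And>k. hankel (H k)" and M: "\<And>i j. M i j = (\<Sum>k\<le>d. sobolev_term k (H k) i j)"
    using Sum_any_sobolev_term[OF z] by auto
  define h where "h k = H k 0" for k
  have Hh: "H k = (\<lambda>i j. h k (i + j))" for k
    using hankel_entry[OF H[of k]] by (auto simp: h_def)
  have ext: "extracted M d k = H (d - k)" if "k \<le> d" for k
    by (rule residual_hankel_sobolev(2)[OF H M that])
  \<comment> \<open>Position 0 is a Hamburger moment problem, positions 1 to d are problems of
    finite order, and later positions receive the zero measure so that a total family can be
    chosen.\<close>
  have "\<exists>\<nu>. poly_measure \<nu> \<and> (if k = 0 then infinite (measure_support \<nu>) else finite (measure_support \<nu>))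
      \<and> (k \<le> d \<longrightarrow> (\<forall>i. moment \<nu> i = h k i))" for k
  proof (cases "k = 0")
    case True
    have "\<And>n. posdef (h 0) n"
      using assms(2) pos_def_inf_iff[of "h 0"] ext[of d] Hh[of 0] by simp
    then obtain \<nu> where "poly_measure \<nu>" "infinite (measure_support \<nu>)" "\<And>i. moment \<nu> i = h 0 i"
      using hamburger_moment_problem[of "h 0"] by metis
    then show ?thesis using True by auto
  next
    case False
    have "\<exists>\<nu>. poly_measure \<nu> \<and> finite (measure_support \<nu>) \<and> (\<forall>i. moment \<nu> i = h k i)" if k: "k \<le> d"
    proof -
      obtain m where "pos_def_order m (\<lambda>i j. h k (i + j))"
        using fin[of "d - k"] ext[of "d - k"] Hh[of k] False k
        by (auto simp: diff_diff_cancel[OF k])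
      then show ?thesis using finite_order_moment_problem[of m "h k"] by metis
    qed
    moreover have "poly_measure (atomic_measure {} (\<lambda>_. 0)) \<and> finite (measure_support (atomic_measure {} (\<lambda>_. 0)))"
      using poly_measure_atomic[of "{}" "\<lambda>_. 0"] finite_support_atomic[of "{}" "\<lambda>_. 0"] by simp
    ultimately show ?thesis using False by (cases "k \<le> d") auto
  qed
  then obtain \<mu> where \<mu>: "\<And>k. poly_measure (\<mu> k)"
    "\<And>k. if k = 0 then infinite (measure_support (\<mu> k)) else finite (measure_support (\<mu> k))"
    "\<And>k i. k \<le> d \<Longrightarrow> moment (\<mu> k) i = h k i"
    by metis
  show ?thesis
  proof (rule that[of \<mu>])
    show "infinite (measure_support (\<mu> 0))" using \<mu>(2)[of 0] by simp
    show "finite (measure_support (\<mu> k))" if "k \<in> {1..d}" for k using \<mu>(2)[of k] that by auto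
    show "M i j = (\<Sum>k\<le>d. sobolev_term k (hankel_moments \<mu> k) i j)" for i j
      unfolding M by (intro sum.cong refl) (simp add: hankel_moments_def \<mu>(3) Hh)
  qed (rule \<mu>(1))
qed

theorem theorem11:
  fixes G :: infmat and t00 :: real
  assumes "nondegenerate_hessenberg G" and "t00 > 0"
  shows "(\<exists>d \<mu>. sobolev_measures d \<mu> \<and>
             infinite (measure_support (\<mu> 0)) \<and>
             (\<forall>k\<in>{1..d}. finite (measure_support (\<mu> k))) \<and>
             (\<forall>p q. sobolev_form d \<mu> p q = hessenberg_form G t00 p q))
         \<longleftrightarrow>
         (\<exists>d. hessenberg_sobolev G t00 d \<and>
             pos_def_inf (extracted (formal_moments G t00) d d) \<and>
             (\<forall>k<d. \<exists>m. pos_def_order m (extracted (formal_moments G t00) d k)))"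
    (is "?L \<longleftrightarrow> ?R")
proof -
  have form: "hessenberg_form G t00 = bilinear_form (formal_moments G t00)"
    by (intro ext) (simp add: hessenberg_form_def bilinear_form_def)
  \<comment> \<open>Equality of forms amounts to equality of matrices, so both directions concern
    the Hankel decomposition of \<open>formal_moments G t00\<close>.\<close>
  show ?thesis
    unfolding form hessenberg_sobolev_def sobolev_measures_iff
  proof
    assume "\<exists>d \<mu>. ((\<forall>k\<le>d. poly_measure (\<mu> k)) \<and> infinite (measure_support (\<mu> 0))) \<and>
      infinite (measure_support (\<mu> 0)) \<and> (\<forall>k\<in>{1..d}. finite (measure_support (\<mu> k))) \<and>
      (\<forall>p q. sobolev_form d \<mu> p q = bilinear_form (formal_moments G t00) p q)"
    then obtain d \<mu> where *: "\<And>k. k \<le> d \<Longrightarrow> poly_measure (\<mu> k)" "infinite (measure_support (\<mu> 0))"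
      "\<And>k. k \<in> {1..d} \<Longrightarrow> finite (measure_support (\<mu> k))"
      "\<forall>p q. sobolev_form d \<mu> p q = bilinear_form (formal_moments G t00) p q"
      by blast
    show "\<exists>d. hankel_sobolev (formal_moments G t00) d \<and>
        pos_def_inf (extracted (formal_moments G t00) d d) \<and>
        (\<forall>k<d. \<exists>m. pos_def_order m (extracted (formal_moments G t00) d k))"
      using *(4) sobolev_form_eq_bilinear_form_iff[of d \<mu>, OF *(1)]
      by (intro sobolev_moments_necessary[of d \<mu>, OF *(1-3)]) auto
  next
    assume "\<exists>d. hankel_sobolev (formal_moments G t00) d \<and>
        pos_def_inf (extracted (formal_moments G t00) d d) \<and>
        (\<forall>k<d. \<exists>m. pos_def_order m (extracted (formal_moments G t00) d k))"
    then obtain d where d: "hankel_sobolev (formal_moments G t00) d"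
        "pos_def_inf (extracted (formal_moments G t00) d d)"
        "\<And>k. k < d \<Longrightarrow> \<exists>m. pos_def_order m (extracted (formal_moments G t00) d k)"
      by blast
    obtain \<mu> where *: "\<And>k. poly_measure (\<mu> k)" "infinite (measure_support (\<mu> 0))"
      "\<And>k. k \<in> {1..d} \<Longrightarrow> finite (measure_support (\<mu> k))"
      "\<And>i j. formal_moments G t00 i j = (\<Sum>k\<le>d. sobolev_term k (hankel_moments \<mu> k) i j)"
      using sobolev_moments_sufficient[OF d] by metis
    then show "\<exists>d \<mu>. ((\<forall>k\<le>d. poly_measure (\<mu> k)) \<and> infinite (measure_support (\<mu> 0))) \<and>
      infinite (measure_support (\<mu> 0)) \<and> (\<forall>k\<in>{1..d}. finite (measure_support (\<mu> k))) \<and>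
      (\<forall>p q. sobolev_form d \<mu> p q = bilinear_form (formal_moments G t00) p q)"
      using sobolev_form_eq_bilinear_form_iff[of d \<mu> "formal_moments G t00"]
      by (intro exI[of _ d] exI[of _ \<mu>]) auto
  qed
qed

end
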